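(* Let $\{(X_i,\vdash,\dashv,\perp)\mid i\in I\}$ be a family of (pairwise) disjoint trioids. Let the set of words $\mathsf{FP}(X_i)_{i\in I}$, the dot-removing map $\varphi$ and the map $\mathsf{Red}$ be as defined in the context. Then $(\mathsf{FP}(X_i)_{i\in I},\vdash',\dashv',\perp')$ is the free product of $\{X_i\mid i\in I\}$ with the following products: $$y_1\cdots y_n\vdash' z_1\cdots z_m=\varphi(y_1)\cdots\varphi(y_{n-1})\,\mathsf{Red}(\varphi(y_n)z_1)\,z_2\cdots z_m,$$ $$y_1\cdots y_n\dashv' z_1\cdots z_m=y_1\cdots y_{n-1}\,\mathsf{Red}(y_n\varphi(z_1))\,\varphi(z_2)\cdots\varphi(z_m),$$ $$y_1\cdots y_n\perp' z_1\cdots z_m=y_1\cdots y_{n-1}\,\mathsf{Red}(y_nz_1)\,z_2\cdots z_m,$$ for all $y_1\cdots y_n,\ z_1\cdots z_m\in \mathsf{FP}(X_i)_{i\in I}$.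
   Context: A trioid is a set $T$ with three associative binary operations $\vdash,\dashv,\perp$ satisfying, for all $a,b,c\in T$: $a\dashv(b\vdash c)=a\dashv(b\dashv c)$; $(a\dashv b)\vdash c=(a\vdash b)\vdash c$; $a\vdash(b\dashv c)=(a\vdash b)\dashv c$; $a\dashv(b\perp c)=a\dashv(b\dashv c)$; $(a\perp b)\vdash c=(a\vdash b)\vdash c$; $a\vdash(b\perp c)=(a\vdash b)\perp c$; $a\perp(b\dashv c)=(a\perp b)\dashv c$; $a\perp(b\vdash c)=(a\dashv b)\perp c$. Free product: a trioid $T$ is the free product of trioids $\{T_i\mid i\in I\}$ if there are injective trioid homomorphisms $\tau_i:T_i\to T$ ($i\in I$) such that for every trioid $T'$ and every family of trioid homomorphisms $\phi_i:T_i\to T'$ there is a unique trioid homomorphism $\eta:T\to T'$ with $\eta\tau_i=\phi_i$ for all $i\in I$. It is unique up to isomorphism. Fix a field $k$. For a set $Z$, $k\langle Z\rangle$ is the free associative algebra over $k$ with linear basis the free monoid $Z^*$. Let $\dot X_i=\{\dot x\mid x\in X_i\}$ be a disjoint copy of $X_i$, and for $y\in X_i\cup\dot X_i$ put $\mathsf{ind}(y)=i$. Let $\varphi:k\langle\bigcup_{i\in I}(X_i\cup\dot X_i)\rangle\to k\langle\bigcup_{i\in I}X_i\rangle$ be the algebra homomorphism removing dots: $\varphi(x)=x$, $\varphi(\dot x)=x$ for $x\in\bigcup_{i\in I}X_i$. Assume $I$ and each $X_i$ are well-ordered. Order $\bigcup_{i\in I}(X_i\cup\dot X_i)$ by: $x>y$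 if $x\in X_i$, $y\in X_j$ with $i>j$ (inside each $X_i$ use the given order); $\dot x>\dot y$ if $x>y$; and $\dot x>y$ for all undotted $x,y$. Order words by the degree-lexicographic order (compare first lengths, then lexicographically). The leading monomial $\bar f$ of a nonzero polynomial $f$ is its largest word. A Gröbner-Shirshov basis of an ideal is a generating set of monic polynomials such that the leading monomial of every nonzero element of the ideal contains the leading monomial of some element of the set as a factor. For $x,y\in X_i$ and $\delta\in\{\vdash,\dashv,\perp\}$ let $\{x\delta y\}\in X_i$ be the value of $x\delta y$ in the trioid $X_i$. Let $P_i=\{xy-\{x\delta y\}\mid x,y\in X_i,\ \delta\in\{\vdash,\dashv,\perp\}\}\subseteq k\langle X_i\rangle$, and let $Q_i\subseteq k\langle X_i\cup\dot X_i\rangle$ consist of all $x\dot y-\dot c$ with $c=\{x\vdash y\}$, all $\dot xy-\dot b$ with $b=\{x\dashv y\}$, and all $\dot x\dot y-\dot d$ with $d=\{x\perp y\}$, for $x,y\in X_i$. Let $R_i$ be a Gröbner-Shirshov basis of the ideal of $k\langle X_i\rangle$ generated by $P_i$, with $P_i\subseteq R_i$, and put $X_i'=X_i\setminus\{\bar f\mid f\in R_i\}$. Let $\rho_i'$ be the congruence of the trioid $X_i$ generated by all pairs $(x\delta y,x\delta'y)$ with $x,y\in X_i$, $\delta,\delta'\in\{\vdash,\dashv,\perp\}$; the elements of $X_i'$ form a set of normal forms for the elements of the quotient trioid $X_i/\rho_i'$, in which the three operations coincide. Put $Y_3=\bigcup_{i\in I}(\dot X_i\cup X_i')$. Let $\mathsf{FP}(X_i)_{i\in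 I}$ be the set of all words $y_1\cdots y_n$ ($n\ge1$) with letters $y_1,\dots,y_n\in Y_3$, at least one of which is dotted (i.e. lies in some $\dot X_i$), such that $\mathsf{ind}(y_p)\ne\mathsf{ind}(y_{p+1})$ for $1\le p\le n-1$. For letters $y,z\in Y_3$, $\mathsf{Red}(yz)$ is the word on $Y_3$ which is the normal form of $yz$ in the associative algebra $k\langle\bigcup_{i\in I}(X_i\cup\dot X_i)\mid\bigcup_{i\in I}(Q_i\cup P_i)\rangle$ obtained by applying the Gröbner-Shirshov basis $\bigcup_{i\in I}(Q_i\cup R_i)$. Explicitly: (i) if $\mathsf{ind}(y)\ne\mathsf{ind}(z)$, then $\mathsf{Red}(yz)=yz$; (ii) if $y,z\in X_i'$, then $\mathsf{Red}(yz)$ is the letter of $X_i'$ that is $\rho_i'$-congruent to $y\vdash z$; (iii) if $y=\dot a\in\dot X_i$ and $z\in X_i'$, then $\mathsf{Red}(yz)=\dot b$ where $b=a\dashv z$ in $X_i$; if $y\in X_i'$ and $z=\dot a\in\dot X_i$, then $\mathsf{Red}(yz)=\dot c$ where $c=y\vdash a$ in $X_i$; if $y=\dot a$ and $z=\dot b$ are both in $\dot X_i$, then $\mathsf{Red}(yz)=\dot d$ where $d=a\perp b$ in $X_i$.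
   Formalization: In the products, φ(y_1)…φ(y_{n-1}) and φ(z_2)…φ(z_m) are replaced by their normal forms (letters in X_i'), and Red is also applied when φ(y_n) or φ(z_1) is not in X_i'; read literally, FP is not closed under the first two products. *)

theory Defs
  imports
    "HOL-Library.Poly_Mapping"
    "HOL-Library.Sublist"
    "HOL-Library.FuncSet"
    "HOL-Library.Disjoint_Sets"
    "HOL-Algebra.Ideal"
begin

section \<open>Trioids and free products\<close>

record 'a trioid = "'a partial_object" +
  lprod :: "'a \<Rightarrow> 'a \<Rightarrow> 'a" (infixl "\<turnstile>\<index>" 70)
  rprod :: "'a \<Rightarrow> 'a \<Rightarrow> 'a" (infixl "\<stileturn>\<index>" 70)
  pprod :: "'a \<Rightarrow> 'a \<Rightarrow> 'a" (infixl "\<perp>\<index>" 70)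

locale trioid =
  fixes T (structure)
  assumes l_closed: "\<lbrakk>a \<in> carrier T; b \<in> carrier T\<rbrakk> \<Longrightarrow> a \<turnstile> b \<in> carrier T"
    and r_closed: "\<lbrakk>a \<in> carrier T; b \<in> carrier T\<rbrakk> \<Longrightarrow> a \<stileturn> b \<in> carrier T"
    and p_closed: "\<lbrakk>a \<in> carrier T; b \<in> carrier T\<rbrakk> \<Longrightarrow> a \<perp> b \<in> carrier T"
    and l_assoc: "\<lbrakk>a \<in> carrier T; b \<in> carrier T; c \<in> carrier T\<rbrakk> \<Longrightarrow> (a \<turnstile> b) \<turnstile> c = a \<turnstile> (b \<turnstile> c)"
    and r_assoc: "\<lbrakk>a \<in> carrier T; b \<in> carrier T; c \<in> carrier T\<rbrakk> \<Longrightarrow> (a \<stileturn> b) \<stileturn> c = a \<stileturn> (b \<stileturn> c)"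
    and p_assoc: "\<lbrakk>a \<in> carrier T; b \<in> carrier T; c \<in> carrier T\<rbrakk> \<Longrightarrow> (a \<perp> b) \<perp> c = a \<perp> (b \<perp> c)"
    and r_l: "\<lbrakk>a \<in> carrier T; b \<in> carrier T; c \<in> carrier T\<rbrakk> \<Longrightarrow> a \<stileturn> (b \<turnstile> c) = a \<stileturn> (b \<stileturn> c)"
    and rl_l: "\<lbrakk>a \<in> carrier T; b \<in> carrier T; c \<in> carrier T\<rbrakk> \<Longrightarrow> (a \<stileturn> b) \<turnstile> c = (a \<turnstile> b) \<turnstile> c"
    and l_r: "\<lbrakk>a \<in> carrier T; b \<in> carrier T; c \<in> carrier T\<rbrakk> \<Longrightarrow> a \<turnstile> (b \<stileturn> c) = (a \<turnstile> b) \<stileturn> c"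
    and r_p: "\<lbrakk>a \<in> carrier T; b \<in> carrier T; c \<in> carrier T\<rbrakk> \<Longrightarrow> a \<stileturn> (b \<perp> c) = a \<stileturn> (b \<stileturn> c)"
    and p_l: "\<lbrakk>a \<in> carrier T; b \<in> carrier T; c \<in> carrier T\<rbrakk> \<Longrightarrow> (a \<perp> b) \<turnstile> c = (a \<turnstile> b) \<turnstile> c"
    and l_p: "\<lbrakk>a \<in> carrier T; b \<in> carrier T; c \<in> carrier T\<rbrakk> \<Longrightarrow> a \<turnstile> (b \<perp> c) = (a \<turnstile> b) \<perp> c"
    and p_r: "\<lbrakk>a \<in> carrier T; b \<in> carrier T; c \<in> carrier T\<rbrakk> \<Longrightarrow> a \<perp> (b \<stileturn> c) = (a \<perp> b) \<stileturn> c"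
    and p_lr: "\<lbrakk>a \<in> carrier T; b \<in> carrier T; c \<in> carrier T\<rbrakk> \<Longrightarrow> a \<perp> (b \<turnstile> c) = (a \<stileturn> b) \<perp> c"

definition trioid_hom :: "'a trioid \<Rightarrow> 'b trioid \<Rightarrow> ('a \<Rightarrow> 'b) set" where
  "trioid_hom S T = {f \<in> carrier S \<rightarrow> carrier T. \<forall>x\<in>carrier S. \<forall>y\<in>carrier S.
     f (x \<turnstile>\<^bsub>S\<^esub> y) = f x \<turnstile>\<^bsub>T\<^esub> f y \<and>
     f (x \<stileturn>\<^bsub>S\<^esub> y) = f x \<stileturn>\<^bsub>T\<^esub> f y \<and>
     f (x \<perp>\<^bsub>S\<^esub> y) = f x \<perp>\<^bsub>T\<^esub> f y}"

text \<open>
  The trioid \<open>T\<close>, with the injections \<open>\<tau>\<close>, is the free product of the trioids \<open>X i\<close>.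
  HOL cannot quantify over the type \<open>'c\<close> of the test trioids inside a formula, so it is a
  parameter: the universal property is the statement for every type \<open>'c\<close>. The injections are an
  argument, rather than existentially quantified, so that they do not depend on \<open>'c\<close>.
  Restricting \<open>\<eta>\<close> to extensional functions makes it unique as a map on \<open>carrier T\<close>.
\<close>

definition is_free_product ::
  "'c itself \<Rightarrow> 'i set \<Rightarrow> ('i \<Rightarrow> 'a trioid) \<Rightarrow> 'b trioid \<Rightarrow> ('i \<Rightarrow> 'a \<Rightarrow> 'b) \<Rightarrow> bool" where
  "is_free_product _ I X T \<tau> \<longleftrightarrow>
     trioid T \<and>
     (\<forall>i\<in>I. \<tau> i \<in> trioid_hom (X i) T \<and> inj_on (\<tau> i) (carrier (X i))) \<and>
     (\<forall>(T' :: 'c trioid) \<phi>. trioid T' \<longrightarrow> (\<forall>i\<in>I. \<phi> i \<in> trioid_hom (X i) T') \<longrightarrow>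
        (\<exists>!\<eta>. \<eta> \<in> extensional (carrier T) \<and> \<eta> \<in> trioid_hom T T' \<and>
              (\<forall>i\<in>I. \<forall>x\<in>carrier (X i). \<eta> (\<tau> i x) = \<phi> i x)))"


section \<open>Free associative algebras and Groebner-Shirshov bases\<close>

text \<open>
  Lists under concatenation are the free monoid, and the convolution product on
  \<^typ>\<open>'z list \<Rightarrow>\<^sub>0 'k\<close> is then the multiplication of the free associative algebra.
\<close>

instantiation list :: (type) monoid_add
begin
definition zero_list :: "'a list" where "zero_list = []"
definition plus_list :: "'a list \<Rightarrow> 'a list \<Rightarrow> 'a list" where "plus_list u v = u @ v"
instance by standard (simp_all add: zero_list_def plus_list_def)
end

definition free_alg :: "'z set \<Rightarrow> ('z list \<Rightarrow>\<^sub>0 'k::field) ring" where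
  "free_alg Z = \<lparr>carrier = {f. Poly_Mapping.keys f \<subseteq> lists Z},
                 mult = (*), one = 1, zero = 0, add = (+)\<rparr>"

abbreviation word_poly :: "'z list \<Rightarrow> 'z list \<Rightarrow>\<^sub>0 'k::field" where
  "word_poly w \<equiv> Poly_Mapping.single w 1"

lemma ring_free_alg: "ring (free_alg Z :: ('z list \<Rightarrow>\<^sub>0 'k::field) ring)"
proof (rule ringI)
  show "abelian_group (free_alg Z :: ('z list \<Rightarrow>\<^sub>0 'k) ring)"
  proof (rule abelian_groupI)
    fix x y :: "'z list \<Rightarrow>\<^sub>0 'k"
    assume "x \<in> carrier (free_alg Z)" "y \<in> carrier (free_alg Z)"
    then show "x \<oplus>\<^bsub>free_alg Z\<^esub> y \<in> carrier (free_alg Z)"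
      using Poly_Mapping.keys_add[of x y] by (auto simp: free_alg_def)
  next
    fix x :: "'z list \<Rightarrow>\<^sub>0 'k"
    assume "x \<in> carrier (free_alg Z)"
    then show "\<exists>y\<in>carrier (free_alg Z). y \<oplus>\<^bsub>free_alg Z\<^esub> x = \<zero>\<^bsub>free_alg Z\<^esub>"
      by (intro bexI[of _ "- x"]) (auto simp: free_alg_def)
  qed (auto simp: free_alg_def algebra_simps)
  show "Group.monoid (free_alg Z :: ('z list \<Rightarrow>\<^sub>0 'k) ring)"
  proof (rule monoidI)
    fix x y :: "'z list \<Rightarrow>\<^sub>0 'k"
    assume "x \<in> carrier (free_alg Z)" "y \<in> carrier (free_alg Z)"
    then show "x \<otimes>\<^bsub>free_alg Z\<^esub> y \<in> carrier (free_alg Z)"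
      using Poly_Mapping.keys_mult[of x y] by (fastforce simp: free_alg_def plus_list_def)
  qed (auto simp: free_alg_def algebra_simps zero_list_def)
qed (auto simp: free_alg_def algebra_simps)

text \<open>In the following, \<open>ord\<close> is a strict order on words.\<close>

definition leading_monomial ::
  "('z list \<times> 'z list) set \<Rightarrow> ('z list \<Rightarrow>\<^sub>0 'k::field) \<Rightarrow> 'z list" where
  "leading_monomial ord f =
     (THE w. w \<in> Poly_Mapping.keys f \<and> (\<forall>v\<in>Poly_Mapping.keys f. v \<noteq> w \<longrightarrow> (v, w) \<in> ord))"

definition groebner_shirshov_basis ::
  "('z list \<times> 'z list) set \<Rightarrow> 'z set \<Rightarrow> ('z list \<Rightarrow>\<^sub>0 'k::field) set \<Rightarrow> ('z list \<Rightarrow>\<^sub>0 'k) set \<Rightarrow> bool"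
where
  "groebner_shirshov_basis ord Z J S \<longleftrightarrow>
     S \<subseteq> carrier (free_alg Z) \<and>
     genideal (free_alg Z) S = J \<and>
     (\<forall>s\<in>S. s \<noteq> 0 \<and> Poly_Mapping.lookup s (leading_monomial ord s) = 1) \<and>
     (\<forall>f\<in>J. f \<noteq> 0 \<longrightarrow> (\<exists>s\<in>S. sublist (leading_monomial ord s) (leading_monomial ord f)))"

text \<open>
  The normal form of a word \<open>w\<close> modulo the ideal \<open>J\<close> with respect to the basis \<open>S\<close> of \<open>J\<close>:
  the irreducible word congruent to \<open>w\<close>. (For ideals generated by differences of words,
  as below, the normal form of a word is again a word.)
\<close>

definition normal_form ::
  "('z list \<times> 'z list) set \<Rightarrow> 'z set \<Rightarrow> ('z list \<Rightarrow>\<^sub>0 'k::field) set \<Rightarrow> ('z list \<Rightarrow>\<^sub>0 'k) set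
     \<Rightarrow> 'z list \<Rightarrow> 'z list" where
  "normal_form ord Z J S w =
     (THE v. v \<in> lists Z \<and> (\<forall>s\<in>S. \<not> sublist (leading_monomial ord s) v) \<and>
             word_poly w - word_poly v \<in> J)"


section \<open>The dotted alphabet\<close>

datatype 'a letter = Plain 'a | Dotted 'a

primrec undot :: "'a letter \<Rightarrow> 'a letter" where
  "undot (Plain x) = Plain x"
| "undot (Dotted x) = Plain x"

primrec base :: "'a letter \<Rightarrow> 'a" where
  "base (Plain x) = x"
| "base (Dotted x) = x"

definition is_dotted :: "'a letter \<Rightarrow> bool" where
  "is_dotted y \<longleftrightarrow> (\<exists>x. y = Dotted x)"

text \<open>The family \<open>X\<close> is meant to be disjoint, so that a letter determines its index.\<close>

definition ind :: "'i set \<Rightarrow> ('i \<Rightarrow> 'a trioid) \<Rightarrow> 'a letter \<Rightarrow> 'i" where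
  "ind I X y = (THE i. i \<in> I \<and> base y \<in> carrier (X i))"

definition alphabet :: "'i set \<Rightarrow> ('i \<Rightarrow> 'a trioid) \<Rightarrow> 'a letter set" where
  "alphabet I X = (\<Union>i\<in>I. Plain ` carrier (X i) \<union> Dotted ` carrier (X i))"

text \<open>
  The orders on letters and words are strict. The arguments \<open>rI\<close> and \<open>rX i\<close> are well-orders on
  \<open>I\<close> and \<open>carrier (X i)\<close> in the (reflexive) sense of \<^const>\<open>well_order_on\<close>.
\<close>

definition base_less ::
  "'i set \<Rightarrow> ('i \<Rightarrow> 'a trioid) \<Rightarrow> ('i \<times> 'i) set \<Rightarrow> ('i \<Rightarrow> ('a \<times> 'a) set) \<Rightarrow> ('a \<times> 'a) set" where
  "base_less I X rI rX =
     {(x, y). \<exists>i\<in>I. \<exists>j\<in>I. x \<in> carrier (X i) \<and> y \<in> carrier (X j) \<and>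
        (i \<noteq> j \<and> (i, j) \<in> rI \<or> i = j \<and> x \<noteq> y \<and> (x, y) \<in> rX i)}"

definition letter_less ::
  "'i set \<Rightarrow> ('i \<Rightarrow> 'a trioid) \<Rightarrow> ('i \<times> 'i) set \<Rightarrow> ('i \<Rightarrow> ('a \<times> 'a) set)
     \<Rightarrow> ('a letter \<times> 'a letter) set" where
  "letter_less I X rI rX =
     {(Plain x, Plain y) | x y. (x, y) \<in> base_less I X rI rX} \<union>
     {(Dotted x, Dotted y) | x y. (x, y) \<in> base_less I X rI rX} \<union>
     {(Plain x, Dotted y) | x y. x \<in> (\<Union>i\<in>I. carrier (X i)) \<and> y \<in> (\<Union>i\<in>I. carrier (X i))}"

definition word_less ::
  "'i set \<Rightarrow> ('i \<Rightarrow> 'a trioid) \<Rightarrow> ('i \<times> 'i) set \<Rightarrow> ('i \<Rightarrow> ('a \<times> 'a) set)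
     \<Rightarrow> ('a letter list \<times> 'a letter list) set" where
  "word_less I X rI rX = lenlex (letter_less I X rI rX)"

definition P_rel :: "'a trioid \<Rightarrow> ('a letter list \<Rightarrow>\<^sub>0 'k::field) set" where
  "P_rel T = (\<Union>x\<in>carrier T. \<Union>y\<in>carrier T.
     (\<lambda>c. word_poly [Plain x, Plain y] - word_poly [Plain c]) `
       {x \<turnstile>\<^bsub>T\<^esub> y, x \<stileturn>\<^bsub>T\<^esub> y, x \<perp>\<^bsub>T\<^esub> y})"

definition Q_rel :: "'a trioid \<Rightarrow> ('a letter list \<Rightarrow>\<^sub>0 'k::field) set" where
  "Q_rel T = (\<Union>x\<in>carrier T. \<Union>y\<in>carrier T.
     {word_poly [Plain x, Dotted y] - word_poly [Dotted (x \<turnstile>\<^bsub>T\<^esub> y)],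
      word_poly [Dotted x, Plain y] - word_poly [Dotted (x \<stileturn>\<^bsub>T\<^esub> y)],
      word_poly [Dotted x, Dotted y] - word_poly [Dotted (x \<perp>\<^bsub>T\<^esub> y)]})"


section \<open>The trioid of normal forms\<close>

text \<open>
  Throughout, \<open>R i\<close> is meant to be a Groebner-Shirshov basis of the ideal of
  \<open>k\<langle>X i\<rangle>\<close> generated by \<open>P_rel (X i)\<close>.
\<close>

definition normal_letters ::
  "'i set \<Rightarrow> ('i \<Rightarrow> 'a trioid) \<Rightarrow> ('i \<times> 'i) set \<Rightarrow> ('i \<Rightarrow> ('a \<times> 'a) set)
     \<Rightarrow> ('i \<Rightarrow> ('a letter list \<Rightarrow>\<^sub>0 'k::field) set) \<Rightarrow> 'i \<Rightarrow> 'a letter set" where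
  "normal_letters I X rI rX R i =
     {Plain x | x. x \<in> carrier (X i) \<and>
                   [Plain x] \<notin> leading_monomial (word_less I X rI rX) ` R i}"

definition Y3 ::
  "'i set \<Rightarrow> ('i \<Rightarrow> 'a trioid) \<Rightarrow> ('i \<times> 'i) set \<Rightarrow> ('i \<Rightarrow> ('a \<times> 'a) set)
     \<Rightarrow> ('i \<Rightarrow> ('a letter list \<Rightarrow>\<^sub>0 'k::field) set) \<Rightarrow> 'a letter set" where
  "Y3 I X rI rX R = (\<Union>i\<in>I. Dotted ` carrier (X i) \<union> normal_letters I X rI rX R i)"

definition NF ::
  "'i set \<Rightarrow> ('i \<Rightarrow> 'a trioid) \<Rightarrow> ('i \<times> 'i) set \<Rightarrow> ('i \<Rightarrow> ('a \<times> 'a) set)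
     \<Rightarrow> ('i \<Rightarrow> ('a letter list \<Rightarrow>\<^sub>0 'k::field) set) \<Rightarrow> 'a letter list \<Rightarrow> 'a letter list" where
  "NF I X rI rX R =
     normal_form (word_less I X rI rX) (alphabet I X)
       (genideal (free_alg (alphabet I X)) (\<Union>i\<in>I. Q_rel (X i) \<union> P_rel (X i)))
       (\<Union>i\<in>I. Q_rel (X i) \<union> R i)"

definition Red ::
  "'i set \<Rightarrow> ('i \<Rightarrow> 'a trioid) \<Rightarrow> ('i \<times> 'i) set \<Rightarrow> ('i \<Rightarrow> ('a \<times> 'a) set)
     \<Rightarrow> ('i \<Rightarrow> ('a letter list \<Rightarrow>\<^sub>0 'k::field) set) \<Rightarrow> 'a letter \<Rightarrow> 'a letter \<Rightarrow> 'a letter list" where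
  "Red I X rI rX R y z = NF I X rI rX R [y, z]"

text \<open>
  Removing the dot of a letter \<open>Dotted x\<close> yields \<open>Plain x\<close>, which need not be one of the normal
  letters. The words of dot-free letters in the first two products are therefore
  replaced by their normal form (letter by letter: adjacent letters have different
  indices, so no other reduction takes place; normal letters are left unchanged). Likewise
  \<^const>\<open>Red\<close> is applied to arbitrary letters of the alphabet.
\<close>

definition FP ::
  "'i set \<Rightarrow> ('i \<Rightarrow> 'a trioid) \<Rightarrow> ('i \<times> 'i) set \<Rightarrow> ('i \<Rightarrow> ('a \<times> 'a) set)
     \<Rightarrow> ('i \<Rightarrow> ('a letter list \<Rightarrow>\<^sub>0 'k::field) set) \<Rightarrow> 'a letter list trioid" where
  "FP I X rI rX R =
     \<lparr>carrier = {w. w \<noteq> [] \<and> set w \<subseteq> Y3 I X rI rX R \<and> (\<exists>y\<in>set w. is_dotted y) \<and>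
                    successively (\<lambda>y z. ind I X y \<noteq> ind I X z) w},
      lprod = (\<lambda>ys zs. NF I X rI rX R (map undot (butlast ys)) @
                       Red I X rI rX R (undot (last ys)) (hd zs) @ tl zs),
      rprod = (\<lambda>ys zs. butlast ys @ Red I X rI rX R (last ys) (undot (hd zs)) @
                       NF I X rI rX R (map undot (tl zs))),
      pprod = (\<lambda>ys zs. butlast ys @ Red I X rI rX R (last ys) (hd zs) @ tl zs)\<rparr>"

end

theory Submission
  imports Defs
begin

text \<open>
  The ideals in question are generated by differences of words, so that a difference of two words
  lies in the ideal iff the words are congruent; this reduces all questions about normal forms to
  combinatorics of words. Congruent undotted letters of \<open>X i\<close> act in the same way, through \<open>\<turnstile>\<close>
  from the left and through \<open>\<stileturn>\<close> from the right, so the normal letters and the dotted letters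
  of \<open>X i\<close> form a semigroup under \<open>Red\<close>. By van der Waerden's method (letters act on
  alternating words, compatibly with the relations) the alternating words are the normal forms
  modulo the whole ideal. If \<open>N w\<close> is the normal form of \<open>w\<close> and \<open>\<phi>\<close> removes dots, the three
  products of \<open>u\<close> and \<open>v\<close> are \<open>N (\<phi> u @ v)\<close>, \<open>N (u @ \<phi> v)\<close> and \<open>N (u @ v)\<close>, and the trioid axioms
  follow because the congruence is stable under \<open>\<phi>\<close>.

  For the universal property, the same construction is applied to the family whose only member is
  the test trioid \<open>T'\<close>. There every word with a dotted letter reduces to a single dotted letter, and
  reading off this letter is the required homomorphism.
\<close>

section \<open>Ideals generated by differences of words\<close>

text \<open>\<open>step\<close> admits only contexts over \<open>Z\<close>, because an ideal of
  \<open>free_alg Z\<close> is stable only under multiplication by words over \<open>Z\<close>.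
  Building the context into \<open>step\<close> makes it enough to check invariance for one
  rewriting at a time.\<close>

inductive word_cong :: "'z set \<Rightarrow> ('z list \<times> 'z list) set \<Rightarrow> 'z list \<Rightarrow> 'z list \<Rightarrow> bool"
  for Z S where
  refl: "word_cong Z S w w"
| sym: "word_cong Z S v w \<Longrightarrow> word_cong Z S w v"
| trans: "word_cong Z S u v \<Longrightarrow> word_cong Z S v w \<Longrightarrow> word_cong Z S u w"
| step: "(a, b) \<in> S \<Longrightarrow> u \<in> lists Z \<Longrightarrow> v \<in> lists Z \<Longrightarrow> word_cong Z S (u @ a @ v) (u @ b @ v)"

lemma word_cong_context:
  assumes "word_cong Z S w w'" "p \<in> lists Z" "q \<in> lists Z"
  shows "word_cong Z S (p @ w @ q) (p @ w' @ q)"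
  using assms(1)
proof induction
  case (step a b u v)
  then show ?case
    using word_cong.step[of a b S "p @ u" Z "v @ q"] assms by auto
qed (use word_cong.intros in blast)+

lemma word_cong_append:
  assumes "word_cong Z S u u'" "word_cong Z S v v'" "u' \<in> lists Z" "v \<in> lists Z"
  shows "word_cong Z S (u @ v) (u' @ v')"
  using word_cong_context[OF assms(1), of "[]" v] word_cong_context[OF assms(2), of u' "[]"] assms
  by (auto intro: word_cong.trans)

lemma word_cong_map:
  assumes "word_cong Z S w w'" "f ` Z \<subseteq> Z'"
    and "\<And>a b. (a, b) \<in> S \<Longrightarrow> word_cong Z' S' (map f a) (map f b)"
  shows "word_cong Z' S' (map f w) (map f w')"
  using assms(1)
proof induction
  case (step a b u v)
  then have "map f u \<in> lists Z'" "map f v \<in> lists Z'"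
    using assms(2) by (auto simp: image_subset_iff)
  then show ?case
    using word_cong_context[OF assms(3)[OF step(1)]] by simp
qed (use word_cong.intros in blast)+

lemma word_cong_invariant:
  assumes "word_cong Z S w w'"
    and "\<And>a b u v. (a, b) \<in> S \<Longrightarrow> u \<in> lists Z \<Longrightarrow> v \<in> lists Z \<Longrightarrow> h (u @ a @ v) = h (u @ b @ v)"
  shows "h w = h w'"
  using assms(1) by induction (auto simp: assms(2))

lemma word_cong_mono:
  assumes "word_cong Z S w w'" "Z \<subseteq> Z'" "S \<subseteq> S'"
  shows "word_cong Z' S' w w'"
  using assms(1)
proof induction
  case (step a b u v)
  then show ?case
    using assms(2,3) lists_mono[OF assms(2)] by (intro word_cong.step) auto
qed (use word_cong.intros in blast)+

section \<open>Coefficient sums over congruence classes and membership in the ideal\<close>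

definition binomials :: "('z list \<times> 'z list) set \<Rightarrow> ('z list \<Rightarrow>\<^sub>0 'k::field) set" where
  "binomials S = (\<lambda>(a, b). word_poly a - word_poly b) ` S"

text \<open>
  Summing the coefficients over a union of congruence classes of words annihilates the ideal; this
  separates incongruent words modulo the ideal.
\<close>

definition mass :: "'z set \<Rightarrow> ('z \<Rightarrow>\<^sub>0 'k::field) \<Rightarrow> 'k" where
  "mass W f = (\<Sum>w\<in>Poly_Mapping.keys f. if w \<in> W then Poly_Mapping.lookup f w else 0)"

text \<open>Terms may cancel in a sum of polynomials, so key sets are not additive. Summing over a
  common finite superset of the keys makes \<open>mass\<close> additive.\<close>

lemma mass_superset:
  assumes "finite A" "Poly_Mapping.keys f \<subseteq> A"
  shows "mass W f = (\<Sum>w\<in>A. if w \<in> W then Poly_Mapping.lookup f w else 0)"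
  unfolding mass_def
  by (rule sum.mono_neutral_left) (use assms in \<open>auto simp: in_keys_iff\<close>)

lemma mass_add: "mass W (f + g) = mass W f + mass W g"
proof -
  let ?A = "Poly_Mapping.keys f \<union> Poly_Mapping.keys g"
  have "mass W (f + g) = (\<Sum>w\<in>?A. if w \<in> W then Poly_Mapping.lookup (f + g) w else 0)"
    using Poly_Mapping.keys_add[of f g] by (intro mass_superset) auto
  also have "\<dots> = (\<Sum>w\<in>?A. (if w \<in> W then Poly_Mapping.lookup f w else 0) +
      (if w \<in> W then Poly_Mapping.lookup g w else 0))"
    by (intro sum.cong) (auto simp: lookup_add)
  finally show ?thesis
    unfolding sum.distrib by (simp add: mass_superset[of ?A, symmetric])
qed

lemma mass_zero [simp]: "mass W 0 = 0"
  by (simp add: mass_def)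

lemma mass_uminus: "mass W (- f) = - mass W f"
  using mass_add[of W f "- f"] by (simp add: eq_neg_iff_add_eq_0 add.commute)

lemma mass_diff: "mass W (f - g) = mass W f - mass W g"
  using mass_add[of W f "- g"] by (simp add: mass_uminus)

lemma mass_single: "mass W (Poly_Mapping.single w c) = (if w \<in> W then c else 0)"
  by (simp add: mass_def)

lemma keys_subset_induct [consumes 1, case_names zero single_add]:
  assumes "Poly_Mapping.keys f \<subseteq> A" "P 0"
    and "\<And>g w c. P g \<Longrightarrow> w \<in> A \<Longrightarrow> P (Poly_Mapping.single w c + g)"
  shows "P (f :: 'z \<Rightarrow>\<^sub>0 'k::comm_monoid_add)"
  using assms(1)
proof (induction f rule: update_induct)
  case (update f a b)
  have "Poly_Mapping.update a b f = Poly_Mapping.single a b + f"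
    using update(1) by (intro poly_mapping_eqI)
      (auto simp: lookup_update lookup_add lookup_single in_keys_iff when_def)
  moreover have "Poly_Mapping.keys (Poly_Mapping.update a b f) = insert a (Poly_Mapping.keys f)"
    using update(1,2) by (auto simp: in_keys_iff lookup_update split: if_splits)
  ultimately show ?case
    using assms(3) update.IH update.prems by (metis insert_subset)
qed (rule assms(2))

text \<open>Multiplying by a word turns the test set \<open>W\<close> into its preimage under
  concatenation with that word. Such preimages are again closed under congruence, which is what
  makes \<open>massless\<close> an ideal.\<close>

lemma mass_single_mult:
  "mass W (Poly_Mapping.single u c * f) = c * mass {w. u @ w \<in> W} f"
  using subset_UNIV[of "Poly_Mapping.keys f"]
  by (induction f rule: keys_subset_induct)
    (auto simp: mass_add mass_single mult_single plus_list_def algebra_simps)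

lemma mass_mult_single:
  "mass W (f * Poly_Mapping.single u c) = mass {w. w @ u \<in> W} f * c"
  using subset_UNIV[of "Poly_Mapping.keys f"]
  by (induction f rule: keys_subset_induct)
    (auto simp: mass_add mass_single mult_single plus_list_def algebra_simps)

definition cong_closed :: "'z set \<Rightarrow> ('z list \<times> 'z list) set \<Rightarrow> 'z list set \<Rightarrow> bool" where
  "cong_closed Z S W \<longleftrightarrow> (\<forall>w v. word_cong Z S w v \<longrightarrow> w \<in> W \<longrightarrow> v \<in> W)"

lemma cong_closed_left:
  assumes "cong_closed Z S W" "u \<in> lists Z"
  shows "cong_closed Z S {w. u @ w \<in> W}"
  using assms word_cong_context[of Z S _ _ u "[]"] unfolding cong_closed_def by auto

lemma cong_closed_right:
  assumes "cong_closed Z S W" "u \<in> lists Z"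
  shows "cong_closed Z S {w. w @ u \<in> W}"
  using assms word_cong_context[of Z S _ _ "[]" u] unfolding cong_closed_def by auto

text \<open>All closed sets are tested at once: multiplication by a word changes the test set, so
  vanishing on one fixed set would not be stable.\<close>

definition massless ::
  "'z set \<Rightarrow> ('z list \<times> 'z list) set \<Rightarrow> ('z list \<Rightarrow>\<^sub>0 'k::field) set" where
  "massless Z S = {f \<in> carrier (free_alg Z). \<forall>W. cong_closed Z S W \<longrightarrow> mass W f = 0}"

lemma massless_mult:
  assumes "f \<in> massless Z S" "g \<in> carrier (free_alg Z)" "cong_closed Z S W"
  shows "mass W (g * f) = 0" "mass W (f * g) = 0"
proof -
  have f: "mass V f = 0" if "cong_closed Z S V" for V
    using assms(1) that by (simp add: massless_def)
  have g: "Poly_Mapping.keys g \<subseteq> lists Z"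
    using assms(2) by (simp add: free_alg_def)
  show "mass W (g * f) = 0"
    using g by (induction rule: keys_subset_induct)
      (auto simp: mass_add mass_single_mult f cong_closed_left[OF assms(3)] ring_distribs)
  show "mass W (f * g) = 0"
    using g by (induction rule: keys_subset_induct)
      (auto simp: mass_add mass_mult_single f cong_closed_right[OF assms(3)] ring_distribs)
qed

lemma binomials_carrier:
  assumes "S \<subseteq> lists Z \<times> lists Z"
  shows "binomials S \<subseteq> carrier (free_alg Z :: ('z list \<Rightarrow>\<^sub>0 'k::field) ring)"
  using assms Poly_Mapping.keys_diff[of "word_poly _ :: 'z list \<Rightarrow>\<^sub>0 'k" "word_poly _"]
  unfolding binomials_def free_alg_def by (fastforce split: if_splits)

lemma free_alg_a_inv:
  assumes "f \<in> carrier (free_alg Z)"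
  shows "\<ominus>\<^bsub>free_alg Z\<^esub> f = - (f :: 'z list \<Rightarrow>\<^sub>0 'k::field)"
proof -
  interpret ring "free_alg Z :: ('z list \<Rightarrow>\<^sub>0 'k) ring" by (rule ring_free_alg)
  show ?thesis
    using assms by (intro minus_equality) (auto simp: free_alg_def)
qed

lemma massless_ideal: "ideal (massless Z S) (free_alg Z :: ('z list \<Rightarrow>\<^sub>0 'k::field) ring)"
proof -
  interpret ring "free_alg Z :: ('z list \<Rightarrow>\<^sub>0 'k) ring" by (rule ring_free_alg)
  show ?thesis
  proof (rule idealI[OF ring_free_alg])
    show "subgroup (massless Z S) (add_monoid (free_alg Z :: ('z list \<Rightarrow>\<^sub>0 'k) ring))"
    proof
      fix x y :: "'z list \<Rightarrow>\<^sub>0 'k"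
      assume "x \<in> massless Z S" "y \<in> massless Z S"
      then show "x \<otimes>\<^bsub>add_monoid (free_alg Z)\<^esub> y \<in> massless Z S"
        using a_closed[of x y] by (auto simp: massless_def mass_add) (simp add: free_alg_def mass_add)
    next
      fix x :: "'z list \<Rightarrow>\<^sub>0 'k"
      assume "x \<in> massless Z S"
      then show "inv\<^bsub>add_monoid (free_alg Z)\<^esub> x \<in> massless Z S"
        using a_inv_closed[of x] free_alg_a_inv[of x Z]
        by (auto simp: massless_def a_inv_def mass_uminus)
    next
      show "\<one>\<^bsub>add_monoid (free_alg Z)\<^esub> \<in> massless Z S"
        by (auto simp: massless_def free_alg_def)
    qed (auto simp: massless_def)
    fix a x :: "'z list \<Rightarrow>\<^sub>0 'k"
    assume *: "a \<in> massless Z S" "x \<in> carrier (free_alg Z)"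
    have mult: "y \<otimes>\<^bsub>free_alg Z\<^esub> z = y * z" for y z :: "'z list \<Rightarrow>\<^sub>0 'k"
      by (simp add: free_alg_def)
    have "a \<in> carrier (free_alg Z)"
      using * by (simp add: massless_def)
    then show "x \<otimes>\<^bsub>free_alg Z\<^esub> a \<in> massless Z S" "a \<otimes>\<^bsub>free_alg Z\<^esub> x \<in> massless Z S"
      using massless_mult[OF *] m_closed[of a x] m_closed[of x a] *(2)
      by (auto simp: massless_def mult)
  qed
qed

text \<open>The two words of a generator are congruent, so a closed set contains both or neither and
  the coefficients 1 and -1 cancel. The generated ideal is therefore contained in the ideal
  \<open>massless Z S\<close>.\<close>

lemma mass_genideal:
  assumes "S \<subseteq> lists Z \<times> lists Z" "f \<in> genideal (free_alg Z) (binomials S)" "cong_closed Z S W"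
  shows "mass W (f :: 'z list \<Rightarrow>\<^sub>0 'k::field) = 0"
proof -
  interpret ring "free_alg Z :: ('z list \<Rightarrow>\<^sub>0 'k) ring" by (rule ring_free_alg)
  have "mass V g = 0" if gV: "g \<in> binomials S" "cong_closed Z S V" for g :: "'z list \<Rightarrow>\<^sub>0 'k" and V
  proof -
    obtain a b where ab: "(a, b) \<in> S" and g: "g = word_poly a - word_poly b"
      using gV(1) by (auto simp: binomials_def)
    have "word_cong Z S a b" "word_cong Z S b a"
      using word_cong.step[OF ab, of "[]" Z "[]"] by (auto intro: word_cong.sym)
    then show ?thesis
      using gV(2) by (auto simp: g mass_diff mass_single cong_closed_def)
  qed
  then have "binomials S \<subseteq> (massless Z S :: ('z list \<Rightarrow>\<^sub>0 'k) set)"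
    using binomials_carrier[OF assms(1)] by (auto simp: massless_def)
  then have "genideal (free_alg Z) (binomials S) \<subseteq> (massless Z S :: ('z list \<Rightarrow>\<^sub>0 'k) set)"
    by (intro genideal_minimal massless_ideal)
  then show ?thesis
    using assms(2,3) by (auto simp: massless_def)
qed

text \<open>From left to right, the coefficients of the difference over the class of
  \<open>w\<close> must sum to 0; \<open>w\<close> contributes 1, so \<open>v\<close> has to lie in
  that class too. From right to left, each rule of the congruence is matched by a closure property
  of ideals.\<close>

lemma word_poly_diff_mem_genideal_iff:
  assumes "S \<subseteq> lists Z \<times> lists Z" "w \<in> lists Z"
  shows "word_poly w - word_poly v \<in> genideal (free_alg Z) (binomials S :: ('z list \<Rightarrow>\<^sub>0 'k::field) set)
           \<longleftrightarrow> word_cong Z S w v"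
    (is "_ \<in> ?J \<longleftrightarrow> _")
proof
  let ?W = "{x. word_cong Z S w x}"
  assume J: "word_poly w - word_poly v \<in> ?J"
  have "cong_closed Z S ?W"
    by (auto simp: cong_closed_def intro: word_cong.trans)
  from mass_genideal[OF assms(1) J this] show "word_cong Z S w v"
    by (auto simp: mass_diff mass_single word_cong.refl split: if_splits)
next
  interpret ring "free_alg Z :: ('z list \<Rightarrow>\<^sub>0 'k) ring" by (rule ring_free_alg)
  interpret J: ideal ?J "free_alg Z :: ('z list \<Rightarrow>\<^sub>0 'k) ring"
    by (rule genideal_ideal[OF binomials_carrier[OF assms(1)]])
  have ops: "x \<otimes>\<^bsub>free_alg Z\<^esub> y = x * y" "x \<oplus>\<^bsub>free_alg Z\<^esub> y = x + y" for x y :: "'z list \<Rightarrow>\<^sub>0 'k"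
    by (simp_all add: free_alg_def)
  assume "word_cong Z S w v"
  then show "word_poly w - word_poly v \<in> ?J"
  proof induction
    case (refl w)
    then show ?case using J.zero_closed by (simp add: free_alg_def)
  next
    case (sym v w)
    then show ?case
      using J.a_inv_closed[of "word_poly v - word_poly w"] J.Icarr
      by (simp add: free_alg_a_inv)
  next
    case (trans u v w)
    then show ?case
      using J.a_closed[of "word_poly u - word_poly v" "word_poly v - word_poly w"] by (simp add: ops)
  next
    case (step a b u v)
    have uv: "word_poly u \<in> carrier (free_alg Z :: ('z list \<Rightarrow>\<^sub>0 'k) ring)"
      "word_poly v \<in> carrier (free_alg Z :: ('z list \<Rightarrow>\<^sub>0 'k) ring)"
      using step by (auto simp: free_alg_def)
    have "word_poly a - word_poly b \<in> ?J"
      using genideal_self[OF binomials_carrier[OF assms(1)]] step(1) by (force simp: binomials_def)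
    then have "word_poly u * (word_poly a - word_poly b) * word_poly v \<in> ?J"
      using uv J.I_l_closed J.I_r_closed unfolding ops by blast
    then show ?case
      by (simp add: ring_distribs mult_single plus_list_def)
  qed
qed

section \<open>Leading monomials\<close>

lemma finite_total_max:
  assumes "finite A" "A \<noteq> {}" "trans r" "total_on A r"
  shows "\<exists>m\<in>A. \<forall>x\<in>A. x \<noteq> m \<longrightarrow> (x, m) \<in> r"
  using assms(1,2,4)
proof (induction rule: finite_ne_induct)
  case (insert a A)
  then obtain m where m: "m \<in> A" "\<forall>x\<in>A. x \<noteq> m \<longrightarrow> (x, m) \<in> r"
    by (auto simp: total_on_def)
  consider "(a, m) \<in> r" | "(m, a) \<in> r"
    using insert m by (auto simp: total_on_def)
  then show ?case
  proof cases
    case 1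
    with m show ?thesis by blast
  next
    case 2
    with m assms(3) show ?thesis by (auto dest: transD)
  qed
qed simp

lemma leading_monomial_eqI:
  assumes "trans ord" "irrefl ord" "w \<in> Poly_Mapping.keys f"
    and "\<And>v. v \<in> Poly_Mapping.keys f \<Longrightarrow> v \<noteq> w \<Longrightarrow> (v, w) \<in> ord"
  shows "leading_monomial ord f = w"
  unfolding leading_monomial_def
proof (rule the_equality)
  fix v assume v: "v \<in> Poly_Mapping.keys f \<and> (\<forall>u\<in>Poly_Mapping.keys f. u \<noteq> v \<longrightarrow> (u, v) \<in> ord)"
  show "v = w"
  proof (rule ccontr)
    assume "v \<noteq> w"
    then have "(v, w) \<in> ord" "(w, v) \<in> ord"
      using assms(3,4) v by auto
    then show False
      using assms(1,2) by (auto dest: transD simp: irrefl_def)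
  qed
qed (use assms in auto)

text \<open>Totality is demanded only on words over \<open>Z\<close>, since the order on letters
  compares only letters of the alphabet.\<close>

lemma leading_monomial_greatest:
  assumes "trans ord" "irrefl ord" "total_on (lists Z) ord" "f \<in> carrier (free_alg Z)" "f \<noteq> 0"
  shows "leading_monomial ord f \<in> Poly_Mapping.keys f"
    "v \<in> Poly_Mapping.keys f \<Longrightarrow> v \<noteq> leading_monomial ord f \<Longrightarrow> (v, leading_monomial ord f) \<in> ord"
proof -
  have "Poly_Mapping.keys f \<subseteq> lists Z"
    using assms(4) by (simp add: free_alg_def)
  then obtain m where "m \<in> Poly_Mapping.keys f" "\<forall>x\<in>Poly_Mapping.keys f. x \<noteq> m \<longrightarrow> (x, m) \<in> ord"
    using finite_total_max[of "Poly_Mapping.keys f" ord] assms(1,3,5)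
      total_on_subset[of "lists Z" ord "Poly_Mapping.keys f"] by auto
  moreover from this have "leading_monomial ord f = m"
    using assms by (intro leading_monomial_eqI) auto
  ultimately show "leading_monomial ord f \<in> Poly_Mapping.keys f"
    "v \<in> Poly_Mapping.keys f \<Longrightarrow> v \<noteq> leading_monomial ord f \<Longrightarrow> (v, leading_monomial ord f) \<in> ord"
    by auto
qed

lemma total_on_lists_lenlex:
  assumes "total_on Z r"
  shows "total_on (lists Z) (lenlex r)"
proof -
  have same: "(u, v) \<in> lenlex r \<or> (v, u) \<in> lenlex r"
    if "length u = length v" "u \<in> lists Z" "v \<in> lists Z" "u \<noteq> v" for u v
    using that assms by (induction rule: list_induct2) (auto simp: Cons_lenlex_iff total_on_def)
  have shorter: "(u, v) \<in> lenlex r" if "length u < length v" for u v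
    using that by (simp add: lenlex_conv)
  show ?thesis
  proof (rule total_onI)
    fix u v assume "u \<in> lists Z" "v \<in> lists Z" "u \<noteq> v"
    then show "(u, v) \<in> lenlex r \<or> (v, u) \<in> lenlex r"
      using same[of u v] shorter[of u v] shorter[of v u] nat_neq_iff by blast
  qed
qed

section \<open>Families of trioids with normal letters\<close>

text \<open>Pairs of words instead of polynomials: the congruence they generate does not involve the
  coefficient field.\<close>

definition P_pairs :: "('a, 'b) trioid_scheme \<Rightarrow> ('a letter list \<times> 'a letter list) set" where
  "P_pairs T = (\<Union>x\<in>carrier T. \<Union>y\<in>carrier T.
     (\<lambda>c. ([Plain x, Plain y], [Plain c])) ` {x \<turnstile>\<^bsub>T\<^esub> y, x \<stileturn>\<^bsub>T\<^esub> y, x \<perp>\<^bsub>T\<^esub> y})"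

definition Q_pairs :: "('a, 'b) trioid_scheme \<Rightarrow> ('a letter list \<times> 'a letter list) set" where
  "Q_pairs T = (\<Union>x\<in>carrier T. \<Union>y\<in>carrier T.
     {([Plain x, Dotted y], [Dotted (x \<turnstile>\<^bsub>T\<^esub> y)]),
      ([Dotted x, Plain y], [Dotted (x \<stileturn>\<^bsub>T\<^esub> y)]),
      ([Dotted x, Dotted y], [Dotted (x \<perp>\<^bsub>T\<^esub> y)])})"

lemma P_pairsI:
  assumes "x \<in> carrier T" "y \<in> carrier T"
  shows "([Plain x, Plain y], [Plain (x \<turnstile>\<^bsub>T\<^esub> y)]) \<in> P_pairs T"
    "([Plain x, Plain y], [Plain (x \<stileturn>\<^bsub>T\<^esub> y)]) \<in> P_pairs T"
    "([Plain x, Plain y], [Plain (x \<perp>\<^bsub>T\<^esub> y)]) \<in> P_pairs T"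
  using assms by (auto simp: P_pairs_def)

lemma Q_pairsI:
  assumes "x \<in> carrier T" "y \<in> carrier T"
  shows "([Plain x, Dotted y], [Dotted (x \<turnstile>\<^bsub>T\<^esub> y)]) \<in> Q_pairs T"
    "([Dotted x, Plain y], [Dotted (x \<stileturn>\<^bsub>T\<^esub> y)]) \<in> Q_pairs T"
    "([Dotted x, Dotted y], [Dotted (x \<perp>\<^bsub>T\<^esub> y)]) \<in> Q_pairs T"
  using assms by (auto simp: Q_pairs_def)

lemma P_rel_eq_binomials: "P_rel T = binomials (P_pairs T)"
  by (simp only: P_rel_def P_pairs_def binomials_def image_UN image_image prod.case)

lemma Q_rel_eq_binomials: "Q_rel T = binomials (Q_pairs T)"
  by (simp only: Q_rel_def Q_pairs_def binomials_def image_UN image_insert image_empty prod.case)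

section \<open>Congruence of undotted letters in one trioid\<close>

context trioid
begin

abbreviation plain_cong :: "'a letter list \<Rightarrow> 'a letter list \<Rightarrow> bool" where
  "plain_cong \<equiv> word_cong (Plain ` carrier T) (P_pairs T)"

lemma P_pairs_lists: "P_pairs T \<subseteq> lists (Plain ` carrier T) \<times> lists (Plain ` carrier T)"
  by (auto simp: P_pairs_def l_closed r_closed p_closed)

text \<open>A word acts on \<open>c\<close> by iterated \<turnstile>. The axioms
  \<open>rl_l\<close>, \<open>p_l\<close> and \<open>l_assoc\<close> say that all three products of
  two letters act as the two letters in succession, so the action is constant on congruence
  classes.\<close>

lemma plain_cong_l:
  assumes "plain_cong [Plain x] [Plain y]" "c \<in> carrier T"
  shows "x \<turnstile> c = y \<turnstile> c"
proof -
  let ?h = "\<lambda>w. foldr (\<lambda>y c. base y \<turnstile> c) w c"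
  have closed: "?h v \<in> carrier T" if "v \<in> lists (Plain ` carrier T)" for v
    using that by induction (auto simp: assms(2) l_closed)
  have "?h [Plain x] = ?h [Plain y]"
    using assms(1)
  proof (rule word_cong_invariant)
    fix a b u v
    assume "(a, b) \<in> P_pairs T" "v \<in> lists (Plain ` carrier T)"
    then show "?h (u @ a @ v) = ?h (u @ b @ v)"
      using closed[of v] by (auto simp: P_pairs_def rl_l p_l l_assoc)
  qed
  then show ?thesis by simp
qed

text \<open>The mirror image: words act from the right by iterated \<stileturn>, and
  \<open>r_l\<close>, \<open>r_p\<close> and \<open>r_assoc\<close> give the invariance.\<close>

lemma plain_cong_r:
  assumes "plain_cong [Plain x] [Plain y]" "c \<in> carrier T"
  shows "c \<stileturn> x = c \<stileturn> y"
proof -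
  let ?h = "\<lambda>w. foldl (\<lambda>c y. c \<stileturn> base y) c w"
  have closed: "foldl (\<lambda>c y. c \<stileturn> base y) d v \<in> carrier T"
    if "v \<in> lists (Plain ` carrier T)" "d \<in> carrier T" for v d
    using that by (induction arbitrary: d) (auto simp: r_closed)
  have "?h [Plain x] = ?h [Plain y]"
    using assms(1)
  proof (rule word_cong_invariant)
    fix a b u v
    assume "(a, b) \<in> P_pairs T" "u \<in> lists (Plain ` carrier T)"
    then show "?h (u @ a @ v) = ?h (u @ b @ v)"
      using closed[of u c] assms(2) by (auto simp: P_pairs_def r_l r_p r_assoc)
  qed
  then show ?thesis by simp
qed

text \<open>Both sides of every relation are nonempty. This later keeps the empty word from being a
  leading monomial of the basis.\<close>

lemma plain_cong_Nil:
  assumes "plain_cong w w'"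
  shows "w = [] \<longleftrightarrow> w' = []"
  using assms by (rule word_cong_invariant) (auto simp: P_pairs_def)

text \<open>Each of the three products of two letters is congruent to the two-letter word itself, so
  the choice of product does not matter for the class.\<close>

lemma plain_cong_mult:
  assumes "plain_cong [Plain x] [Plain x']" "plain_cong [Plain y] [Plain y']"
    and "x \<in> carrier T" "x' \<in> carrier T" "y \<in> carrier T" "y' \<in> carrier T"
    and "c \<in> {x \<turnstile> y, x \<stileturn> y, x \<perp> y}" "c' \<in> {x' \<turnstile> y', x' \<stileturn> y', x' \<perp> y'}"
  shows "plain_cong [Plain c] [Plain c']"
proof -
  have xy: "plain_cong [Plain x, Plain y] [Plain x', Plain y']"
    using word_cong_append[OF assms(1,2)] assms by simp
  have c: "plain_cong [Plain x, Plain y] [Plain c]"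
    using word_cong.step[of "[Plain x, Plain y]" "[Plain c]" "P_pairs T" "[]" _ "[]"] assms
    by (auto simp: P_pairs_def)
  have c': "plain_cong [Plain x', Plain y'] [Plain c']"
    using word_cong.step[of "[Plain x', Plain y']" "[Plain c']" "P_pairs T" "[]" _ "[]"] assms
    by (auto simp: P_pairs_def)
  show ?thesis
    by (rule word_cong.trans[OF word_cong.trans[OF word_cong.sym[OF c] xy] c'])
qed

end

primrec letter_norm :: "('a \<Rightarrow> 'a) \<Rightarrow> 'a letter \<Rightarrow> 'a letter" where
  "letter_norm nf (Plain x) = Plain (nf x)"
| "letter_norm nf (Dotted x) = Dotted x"

text \<open>The value of \<open>Red\<close> on two letters with the same index.\<close>

fun letter_mult :: "('a, 'b) trioid_scheme \<Rightarrow> ('a \<Rightarrow> 'a) \<Rightarrow> 'a letter \<Rightarrow> 'a letter \<Rightarrow> 'a letter" where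
  "letter_mult T nf (Plain x) (Plain y) = Plain (nf (x \<turnstile>\<^bsub>T\<^esub> y))"
| "letter_mult T nf (Plain x) (Dotted y) = Dotted (x \<turnstile>\<^bsub>T\<^esub> y)"
| "letter_mult T nf (Dotted x) (Plain y) = Dotted (x \<stileturn>\<^bsub>T\<^esub> y)"
| "letter_mult T nf (Dotted x) (Dotted y) = Dotted (x \<perp>\<^bsub>T\<^esub> y)"

lemma undot_undot [simp]: "undot (undot y) = undot y"
  by (cases y) simp_all

text \<open>\<open>nf\<close> stands for any choice of one representative in each class of congruent
  undotted letters. No order and no basis appear, so the locale serves both the given family and the
  family consisting of a test trioid.\<close>

locale trioid_family =
  fixes I :: "'i set" and X :: "'i \<Rightarrow> 'a trioid" and nf :: "'a \<Rightarrow> 'a"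
  assumes trioids: "i \<in> I \<Longrightarrow> trioid (X i)"
    and disjoint: "disjoint_family_on (\<lambda>i. carrier (X i)) I"
    and nf_closed: "i \<in> I \<Longrightarrow> x \<in> carrier (X i) \<Longrightarrow> nf x \<in> carrier (X i)"
    and nf_cong: "i \<in> I \<Longrightarrow> x \<in> carrier (X i) \<Longrightarrow>
          word_cong (Plain ` carrier (X i)) (P_pairs (X i)) [Plain x] [Plain (nf x)]"
    and nf_eqI: "i \<in> I \<Longrightarrow> x \<in> carrier (X i) \<Longrightarrow> y \<in> carrier (X i) \<Longrightarrow>
          word_cong (Plain ` carrier (X i)) (P_pairs (X i)) [Plain x] [Plain y] \<Longrightarrow> nf x = nf y"
begin

abbreviation letters :: "'i \<Rightarrow> 'a letter set" where
  "letters i \<equiv> Plain ` carrier (X i) \<union> Dotted ` carrier (X i)"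

abbreviation idx :: "'a letter \<Rightarrow> 'i" where
  "idx \<equiv> ind I X"

abbreviation relations :: "('a letter list \<times> 'a letter list) set" where
  "relations \<equiv> (\<Union>i\<in>I. Q_pairs (X i) \<union> P_pairs (X i))"

abbreviation cong :: "'a letter list \<Rightarrow> 'a letter list \<Rightarrow> bool" where
  "cong \<equiv> word_cong (alphabet I X) relations"

abbreviation mult :: "'i \<Rightarrow> 'a letter \<Rightarrow> 'a letter \<Rightarrow> 'a letter" where
  "mult i \<equiv> letter_mult (X i) nf"

text \<open>Left multiplication of a normal form by one letter: only the first letter of the word
  can merge with it.\<close>

definition act :: "'a letter \<Rightarrow> 'a letter list \<Rightarrow> 'a letter list" where
  "act y w = (case w of
     [] \<Rightarrow> [letter_norm nf y]
   | z # w' \<Rightarrow> if idx y = idx z then mult (idx y) y z # w' else letter_norm nf y # w)"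

definition normal :: "'a letter list \<Rightarrow> 'a letter list" where
  "normal w = foldr act w []"

definition reduced :: "'a letter list set" where
  "reduced = {w \<in> lists (alphabet I X).
     (\<forall>y\<in>set w. letter_norm nf y = y) \<and> successively (\<lambda>y z. idx y \<noteq> idx z) w}"

lemma idx_eq:
  assumes "i \<in> I" "base y \<in> carrier (X i)"
  shows "idx y = i"
  unfolding ind_def by (rule the_equality) (use assms disjoint in \<open>auto simp: disjoint_family_on_def\<close>)

lemma alphabet_iff: "y \<in> alphabet I X \<longleftrightarrow> idx y \<in> I \<and> y \<in> letters (idx y)"
  using idx_eq by (auto simp: alphabet_def)

lemma letters_idx: "i \<in> I \<Longrightarrow> y \<in> letters i \<Longrightarrow> idx y = i"
  using idx_eq by auto

lemma letters_alphabet: "i \<in> I \<Longrightarrow> y \<in> letters i \<Longrightarrow> y \<in> alphabet I X"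
  by (auto simp: alphabet_def)

lemma idx_undot [simp]: "idx (undot y) = idx y"
  by (cases y) (simp_all add: ind_def)

lemma undot_alphabet [simp]: "undot y \<in> alphabet I X \<longleftrightarrow> y \<in> alphabet I X"
  by (cases y) (auto simp: alphabet_def)

lemma nf_idem: "i \<in> I \<Longrightarrow> x \<in> carrier (X i) \<Longrightarrow> nf (nf x) = nf x"
  using nf_eqI[OF _ _ _ nf_cong] nf_closed by metis

section \<open>The semigroup of letters with a fixed index\<close>

context
  fixes i assumes i: "i \<in> I"
begin

interpretation trioid "X i" by (rule trioids[OF i])

text \<open>In each equation the two products are formed from congruent factors, so
  \<open>plain_cong_mult\<close> makes them congruent and \<open>nf_eqI\<close> gives them the same
  representative.\<close>

lemma nf_mult:
  assumes "x \<in> carrier (X i)" "y \<in> carrier (X i)"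
  shows "nf (x \<stileturn>\<^bsub>X i\<^esub> y) = nf (x \<turnstile>\<^bsub>X i\<^esub> y)" "nf (x \<perp>\<^bsub>X i\<^esub> y) = nf (x \<turnstile>\<^bsub>X i\<^esub> y)"
    "nf (nf x \<turnstile>\<^bsub>X i\<^esub> y) = nf (x \<turnstile>\<^bsub>X i\<^esub> y)" "nf (x \<turnstile>\<^bsub>X i\<^esub> nf y) = nf (x \<turnstile>\<^bsub>X i\<^esub> y)"
proof -
  have eq: "nf c = nf c'"
    if "plain_cong [Plain u] [Plain x]" "plain_cong [Plain v] [Plain y]"
      "u \<in> carrier (X i)" "v \<in> carrier (X i)"
      "c \<in> {u \<turnstile>\<^bsub>X i\<^esub> v, u \<stileturn>\<^bsub>X i\<^esub> v, u \<perp>\<^bsub>X i\<^esub> v}" "c' = x \<turnstile>\<^bsub>X i\<^esub> y" for u v c c'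
  proof (rule nf_eqI[OF i])
    show "plain_cong [Plain c] [Plain c']"
      using plain_cong_mult[OF that(1,2), of c c'] that(3-6) assms by blast
  qed (use that assms in \<open>auto simp: l_closed r_closed p_closed\<close>)
  note refl = word_cong.refl and nf = word_cong.sym[OF nf_cong[OF i]]
  show "nf (x \<stileturn>\<^bsub>X i\<^esub> y) = nf (x \<turnstile>\<^bsub>X i\<^esub> y)" "nf (x \<perp>\<^bsub>X i\<^esub> y) = nf (x \<turnstile>\<^bsub>X i\<^esub> y)"
    by (rule eq[OF refl refl]; simp add: assms)+
  show "nf (nf x \<turnstile>\<^bsub>X i\<^esub> y) = nf (x \<turnstile>\<^bsub>X i\<^esub> y)"
    by (rule eq[OF nf refl]; simp add: assms nf_closed i)
  show "nf (x \<turnstile>\<^bsub>X i\<^esub> nf y) = nf (x \<turnstile>\<^bsub>X i\<^esub> y)"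
    by (rule eq[OF refl nf]; simp add: assms nf_closed i)
qed

text \<open>An undotted letter meets a dotted one through \<turnstile> on the left and \<stileturn>
  on the right, where only its class matters. Hence replacing it by its representative leaves the
  dotted product unchanged.\<close>

lemma mult_nf:
  assumes "x \<in> carrier (X i)" "y \<in> carrier (X i)"
  shows "nf x \<turnstile>\<^bsub>X i\<^esub> y = x \<turnstile>\<^bsub>X i\<^esub> y" "x \<stileturn>\<^bsub>X i\<^esub> nf y = x \<stileturn>\<^bsub>X i\<^esub> y"
  using plain_cong_l[OF nf_cong[OF i]] plain_cong_r[OF nf_cong[OF i]] assms by auto

lemma mult_closed: "y \<in> letters i \<Longrightarrow> z \<in> letters i \<Longrightarrow> mult i y z \<in> letters i"
  by (auto simp: l_closed r_closed p_closed nf_closed i)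

lemma norm_closed: "y \<in> letters i \<Longrightarrow> letter_norm nf y \<in> letters i"
  by (auto simp: nf_closed i)

lemma norm_idem: "y \<in> letters i \<Longrightarrow> letter_norm nf (letter_norm nf y) = letter_norm nf y"
  by (auto simp: nf_idem[OF i])

text \<open>There are eight cases according to which letters are dotted. Once \<open>nf_mult\<close>
  and \<open>mult_nf\<close> have removed the representatives, they are the axioms of a trioid; for
  instance \<open>p_lr\<close> settles dotted, plain, dotted.\<close>

lemma mult_assoc:
  "x \<in> letters i \<Longrightarrow> y \<in> letters i \<Longrightarrow> z \<in> letters i \<Longrightarrow>
    mult i (mult i x y) z = mult i x (mult i y z)"
  by (auto simp: l_closed r_closed p_closed nf_closed i nf_mult mult_nf
      l_assoc r_assoc p_assoc r_l rl_l l_r r_p p_l l_p p_r p_lr)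

lemma mult_norm:
  assumes "y \<in> letters i" "z \<in> letters i"
  shows "mult i (letter_norm nf y) z = mult i y z" "mult i y (letter_norm nf z) = mult i y z"
    "letter_norm nf (mult i y z) = mult i y z"
  using assms nf_idem[OF i]
  by (auto simp: l_closed r_closed p_closed nf_closed i nf_mult mult_nf)

text \<open>The product of two undotted letters is a chosen representative and need not be the right
  side of a relation. It becomes one only up to \<open>letter_norm\<close>, which explains the
  detour through \<open>c\<close>.\<close>

lemma mult_relation:
  assumes "y \<in> letters i" "z \<in> letters i"
  shows "\<exists>c\<in>letters i. ([y, z], [c]) \<in> Q_pairs (X i) \<union> P_pairs (X i) \<and>
      letter_norm nf c = mult i y z"
proof (cases y; cases z)
  fix u v assume "y = Plain u" "z = Plain v"
  then show ?thesis
    using assms by (intro bexI[of _ "Plain (u \<turnstile>\<^bsub>X i\<^esub> v)"]) (auto simp: P_pairsI l_closed)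
next
  fix u v assume "y = Plain u" "z = Dotted v"
  then show ?thesis
    using assms by (intro bexI[of _ "Dotted (u \<turnstile>\<^bsub>X i\<^esub> v)"]) (auto simp: Q_pairsI l_closed)
next
  fix u v assume "y = Dotted u" "z = Plain v"
  then show ?thesis
    using assms by (intro bexI[of _ "Dotted (u \<stileturn>\<^bsub>X i\<^esub> v)"]) (auto simp: Q_pairsI r_closed)
next
  fix u v assume "y = Dotted u" "z = Dotted v"
  then show ?thesis
    using assms by (intro bexI[of _ "Dotted (u \<perp>\<^bsub>X i\<^esub> v)"]) (auto simp: Q_pairsI p_closed)
qed

end

section \<open>The action of letters on alternating words\<close>

lemma relationsE:
  assumes "(a, b) \<in> relations"
  obtains i x y c where "i \<in> I" "a = [x, y]" "b = [c]" "x \<in> letters i" "y \<in> letters i" "c \<in> letters i"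
    "letter_norm nf c = mult i x y"
proof -
  obtain i where i: "i \<in> I" "(a, b) \<in> Q_pairs (X i) \<union> P_pairs (X i)"
    using assms by blast
  interpret trioid "X i" by (rule trioids[OF i(1)])
  have "\<exists>x y c. a = [x, y] \<and> b = [c] \<and> x \<in> letters i \<and> y \<in> letters i \<and> c \<in> letters i \<and>
      letter_norm nf c = mult i x y"
    using i by (auto simp: P_pairs_def Q_pairs_def l_closed r_closed p_closed nf_mult)
  with that[OF i(1)] show thesis by metis
qed

lemma relations_lists: "relations \<subseteq> lists (alphabet I X) \<times> lists (alphabet I X)"
proof (rule subrelI)
  fix a b assume "(a, b) \<in> relations"
  then obtain i x y c where "i \<in> I" "a = [x, y]" "b = [c]" "x \<in> letters i" "y \<in> letters i" "c \<in> letters i"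
    by (rule relationsE)
  then show "(a, b) \<in> lists (alphabet I X) \<times> lists (alphabet I X)"
    by (simp add: letters_alphabet del: Un_iff)
qed

lemma norm_alphabet:
  assumes "y \<in> alphabet I X"
  shows "letter_norm nf y \<in> alphabet I X" "idx (letter_norm nf y) = idx y"
    "letter_norm nf (letter_norm nf y) = letter_norm nf y"
proof -
  have "idx y \<in> I" "y \<in> letters (idx y)"
    using assms alphabet_iff by metis+
  then show "letter_norm nf y \<in> alphabet I X" "idx (letter_norm nf y) = idx y"
    "letter_norm nf (letter_norm nf y) = letter_norm nf y"
    using norm_closed norm_idem letters_idx letters_alphabet by meson+
qed

lemma mult_alphabet:
  assumes "y \<in> alphabet I X" "z \<in> alphabet I X" "idx y = idx z"
  shows "mult (idx z) y z \<in> alphabet I X" "idx (mult (idx z) y z) = idx z"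
    "letter_norm nf (mult (idx z) y z) = mult (idx z) y z"
proof -
  have "idx z \<in> I" "y \<in> letters (idx z)" "z \<in> letters (idx z)"
    using assms alphabet_iff by metis+
  then show "mult (idx z) y z \<in> alphabet I X" "idx (mult (idx z) y z) = idx z"
    "letter_norm nf (mult (idx z) y z) = mult (idx z) y z"
    using mult_closed mult_norm(3) letters_idx letters_alphabet by meson+
qed

lemma act_reduced:
  assumes "y \<in> alphabet I X" "w \<in> reduced"
  shows "act y w \<in> reduced"
proof (cases w)
  case Nil
  with assms(1) show ?thesis by (simp add: act_def reduced_def norm_alphabet)
next
  case (Cons z w')
  have z: "z \<in> alphabet I X"
    using assms(2) Cons by (simp add: reduced_def)
  show ?thesis
  proof (cases "idx y = idx z")
    case True
    with assms Cons show ?thesis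
      by (simp add: act_def reduced_def mult_alphabet[OF assms(1) z] successively_Cons)
  next
    case False
    with assms Cons show ?thesis
      by (simp add: act_def reduced_def norm_alphabet successively_Cons)
  qed
qed

lemma normal_reduced: "w \<in> lists (alphabet I X) \<Longrightarrow> normal w \<in> reduced"
  unfolding normal_def by (induction w) (auto intro: act_reduced, simp add: reduced_def)

lemma reduced_lists: "w \<in> reduced \<Longrightarrow> w \<in> lists (alphabet I X)"
  by (simp add: reduced_def)

lemma normal_id: "w \<in> reduced \<Longrightarrow> normal w = w"
proof (induction w)
  case (Cons y w)
  then have "w \<in> reduced"
    by (auto simp: reduced_def successively_Cons)
  with Cons show ?case
    by (cases w) (auto simp: normal_def act_def reduced_def)
qed (simp add: normal_def)

lemma normal_append: "normal (u @ v) = foldr act u (normal v)"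
  by (simp add: normal_def)

text \<open>A relation replaces \<open>[x, y]\<close> by a letter \<open>c\<close> of the same index
  whose norm is the product of \<open>x\<close> and \<open>y\<close>. If the first letter of
  \<open>w\<close> has that index too, the claim is associativity; otherwise both sides put the same
  letter in front of \<open>w\<close>.\<close>

lemma act_relation:
  assumes "(a, b) \<in> relations" "w \<in> reduced"
  shows "foldr act a w = foldr act b w"
proof -
  obtain i x y c where *: "i \<in> I" "a = [x, y]" "b = [c]" "x \<in> letters i" "y \<in> letters i"
      "c \<in> letters i" "letter_norm nf c = mult i x y"
    using assms(1) by (rule relationsE)
  note i = *(1)
  have idx: "idx x = i" "idx y = i" "idx c = i" "idx (letter_norm nf y) = i"
    using * norm_closed[OF i] letters_idx[OF i] by blast+
  show ?thesis
  proof (cases w)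
    case Nil
    with * idx show ?thesis by (simp add: act_def mult_norm[OF i] del: Un_iff)
  next
    case (Cons z w')
    show ?thesis
    proof (cases "idx z = i")
      case True
      with assms(2) Cons i have z: "z \<in> letters i"
        by (auto simp: reduced_def alphabet_iff simp del: Un_iff)
      have "mult i x (mult i y z) = mult i c z"
        using * z by (metis mult_assoc mult_norm(1))
      moreover have "idx (mult i y z) = i"
        using * z mult_closed letters_idx by meson
      ultimately show ?thesis
        using Cons idx True * by (simp add: act_def)
    next
      case False
      with Cons idx * show ?thesis by (simp add: act_def mult_norm[OF i] del: Un_iff)
    qed
  qed
qed

text \<open>Together with \<open>normal_id\<close> and \<open>cong_normal\<close> this shows that
  each class of words over the alphabet contains exactly one reduced word.\<close>

lemma cong_normal_eq:
  assumes "cong w w'"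
  shows "normal w = normal w'"
  using assms
proof (rule word_cong_invariant)
  fix a b u v assume "(a, b) \<in> relations" "v \<in> lists (alphabet I X)"
  then show "normal (u @ a @ v) = normal (u @ b @ v)"
    by (simp add: normal_append act_relation normal_reduced)
qed

lemma cong_norm:
  assumes "y \<in> alphabet I X"
  shows "cong [y] [letter_norm nf y]"
proof (cases y)
  case (Plain x)
  with assms obtain i where i: "i \<in> I" "x \<in> carrier (X i)"
    by (auto simp: alphabet_def)
  have "Plain ` carrier (X i) \<subseteq> alphabet I X" "P_pairs (X i) \<subseteq> relations"
    using i by (auto simp: alphabet_def)
  from word_cong_mono[OF nf_cong[OF i] this] show ?thesis
    by (simp add: Plain)
qed (simp add: word_cong.refl)

lemma cong_mult:
  assumes "y \<in> alphabet I X" "z \<in> alphabet I X" "idx y = idx z"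
  shows "cong [y, z] [mult (idx z) y z]"
proof -
  let ?i = "idx z"
  have i: "?i \<in> I" and yz: "y \<in> letters ?i" "z \<in> letters ?i"
    using assms alphabet_iff by metis+
  from mult_relation[OF i yz] i obtain c
    where c: "([y, z], [c]) \<in> relations" "letter_norm nf c = mult ?i y z" "c \<in> letters ?i"
    by blast
  have "cong [y, z] [c]"
    using word_cong.step[OF c(1), of "[]" "alphabet I X" "[]"] by simp
  then show ?thesis
    using word_cong.trans[OF _ cong_norm[OF letters_alphabet[OF i c(3)]]] by (simp add: c(2))
qed

lemma cong_act:
  assumes "y \<in> alphabet I X" "w \<in> reduced"
  shows "cong (y # w) (act y w)"
proof (cases w)
  case Nil
  then show ?thesis using cong_norm[OF assms(1)] by (simp add: act_def)
next
  case (Cons z w')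
  have *: "z \<in> alphabet I X" "w \<in> lists (alphabet I X)" "w' \<in> lists (alphabet I X)"
    using assms(2) Cons by (auto simp: reduced_def)
  show ?thesis
  proof (cases "idx y = idx z")
    case True
    then show ?thesis
      using word_cong_context[OF cong_mult[OF assms(1) *(1) True], of "[]" w'] * Cons
      by (simp add: act_def)
  next
    case False
    then show ?thesis
      using word_cong_context[OF cong_norm[OF assms(1)], of "[]" w] * Cons
      by (simp add: act_def)
  qed
qed

lemma cong_normal: "w \<in> lists (alphabet I X) \<Longrightarrow> cong w (normal w)"
proof (induction w)
  case Nil
  show ?case by (simp add: normal_def word_cong.refl)
next
  case (Cons y w)
  then have "cong (y # w) (y # normal w)"
    using word_cong_context[of _ _ w "normal w" "[y]" "[]"] by simp
  moreover have "cong (y # normal w) (normal (y # w))"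
    using cong_act[of y "normal w"] Cons normal_reduced by (simp add: normal_def)
  ultimately show ?case by (rule word_cong.trans)
qed

section \<open>Concatenation, dot removal and normal forms\<close>

lemma normal_lists: "w \<in> lists (alphabet I X) \<Longrightarrow> normal w \<in> lists (alphabet I X)"
  using normal_reduced reduced_lists by blast

text \<open>Without dots, a relation of \<open>Q_pairs\<close> becomes the relation of
  \<open>P_pairs\<close> for the same product, and relations of \<open>P_pairs\<close> are
  unchanged.\<close>

lemma cong_undot:
  assumes "cong w w'"
  shows "cong (map undot w) (map undot w')"
  using assms
proof (rule word_cong_map)
  fix a b assume "(a, b) \<in> relations"
  then obtain i where i: "i \<in> I" "(a, b) \<in> Q_pairs (X i) \<union> P_pairs (X i)" by blast
  then have "(map undot a, map undot b) \<in> P_pairs (X i)"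
    by (auto simp: P_pairs_def Q_pairs_def; blast)
  with i have "(map undot a, map undot b) \<in> relations" by blast
  from word_cong.step[OF this, of "[]" _ "[]"] show "cong (map undot a) (map undot b)"
    by simp
qed auto

lemma undot_lists: "w \<in> lists (alphabet I X) \<Longrightarrow> map undot w \<in> lists (alphabet I X)"
  by auto

text \<open>In every relation the left side has a dotted letter exactly if the right side has
  one.\<close>

lemma cong_has_dotted:
  assumes "cong w w'"
  shows "(\<exists>y\<in>set w. is_dotted y) \<longleftrightarrow> (\<exists>y\<in>set w'. is_dotted y)"
  using assms by (rule word_cong_invariant) (auto simp: P_pairs_def Q_pairs_def is_dotted_def)

lemma normal_alternating:
  assumes "w \<in> lists (alphabet I X)" "successively (\<lambda>y z. idx y \<noteq> idx z) w"
  shows "normal w = map (letter_norm nf) w"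
  using assms
proof (induction w)
  case (Cons y w)
  then show ?case
    by (cases w) (auto simp: normal_def act_def norm_alphabet)
qed (simp add: normal_def)

lemma normal_absorb:
  assumes "u \<in> lists (alphabet I X)" "v \<in> lists (alphabet I X)"
  shows "normal (normal u @ v) = normal (u @ v)" "normal (u @ normal v) = normal (u @ v)"
    "normal (map undot (normal u) @ v) = normal (map undot u @ v)"
    "normal (u @ map undot (normal v)) = normal (u @ map undot v)"
proof -
  note normal_lists[OF assms(1)] normal_lists[OF assms(2)]
  note lists = this assms this[THEN undot_lists] assms[THEN undot_lists]
  note cong = assms[THEN cong_normal]
  show "normal (normal u @ v) = normal (u @ v)" "normal (u @ normal v) = normal (u @ v)"
    "normal (map undot (normal u) @ v) = normal (map undot u @ v)"
    "normal (u @ map undot (normal v)) = normal (u @ map undot v)"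
    by (rule cong_normal_eq[symmetric]; rule word_cong_append;
        (rule word_cong.refl cong cong_undot[OF cong(1)] cong_undot[OF cong(2)] lists)?)+
qed

text \<open>\<open>f\<close> and \<open>g\<close> say which factor loses its dots, so that all three
  products are covered by one statement.\<close>

lemma normal_append_normal:
  assumes "u \<in> lists (alphabet I X)" "v \<in> lists (alphabet I X)"
    and "f \<in> {id, map undot}" "g \<in> {id, map undot}"
  shows "normal (f (normal u) @ g (normal v)) = normal (f u @ g v)"
proof -
  have cong: "cong (h w) (h (normal w))" if "w \<in> lists (alphabet I X)" "h \<in> {id, map undot}" for h w
    using cong_normal[OF that(1)] cong_undot[OF cong_normal[OF that(1)]] that(2) by auto
  have lists: "h w \<in> lists (alphabet I X)" if "w \<in> lists (alphabet I X)" "h \<in> {id, map undot}" for h w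
    using that by auto
  show ?thesis
    using lists[OF normal_lists[OF assms(1)] assms(3)] lists[OF assms(2,4)]
    by (rule cong_normal_eq[symmetric, OF word_cong_append[OF cong[OF assms(1,3)] cong[OF assms(2,4)]]])
qed

lemma normal_pair_same:
  assumes "i \<in> I" "y \<in> letters i" "z \<in> letters i"
  shows "normal [y, z] = [mult i y z]"
  using assms letters_idx norm_closed[OF assms(1,3)]
  by (simp add: normal_def act_def mult_norm del: Un_iff)

text \<open>Letters can merge only where the two alternating words meet. A merged letter keeps the
  common index of \<open>y\<close> and \<open>z\<close>, which differs from the indices of both
  neighbours, so no further merging follows and the three pieces may be normalized
  separately.\<close>

lemma normal_join:
  assumes "u @ [y] \<in> lists (alphabet I X)" "z # v \<in> lists (alphabet I X)"
    and "successively (\<lambda>y z. idx y \<noteq> idx z) (u @ [y])" "successively (\<lambda>y z. idx y \<noteq> idx z) (z # v)"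
  shows "normal (u @ [y] @ z # v) = normal u @ normal [y, z] @ normal v"
proof -
  have alphabet: "u \<in> lists (alphabet I X)" "y \<in> alphabet I X" "z \<in> alphabet I X" "v \<in> lists (alphabet I X)"
    using assms(1,2) by auto
  have alternating: "successively (\<lambda>y z. idx y \<noteq> idx z) u" "successively (\<lambda>y z. idx y \<noteq> idx z) v"
    using assms(3,4) by (auto simp: successively_append_iff successively_Cons)
  have uv: "normal u = map (letter_norm nf) u" "normal v = map (letter_norm nf) v"
    using normal_alternating alphabet alternating by blast+
  have idx_uv: "map idx (normal u) = map idx u" "map idx (normal v) = map idx v"
    using alphabet(1,4) by (auto simp: uv norm_alphabet)
  have yz: "normal [y, z] =
      (if idx y = idx z then [mult (idx z) y z] else [letter_norm nf y, letter_norm nf z])"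
  proof (cases "idx y = idx z")
    case True
    with alphabet(2,3) have "idx z \<in> I" "y \<in> letters (idx z)" "z \<in> letters (idx z)"
      by (simp_all add: alphabet_iff del: Un_iff)
    with True show ?thesis by (simp add: normal_pair_same del: Un_iff)
  next
    case False
    with alphabet(2,3) show ?thesis by (simp add: normal_def act_def norm_alphabet)
  qed
  have "successively (\<noteq>) (map idx (normal u @ normal [y, z] @ normal v))"
    using assms(3,4) alphabet(2,3)
    by (auto simp: yz idx_uv norm_alphabet mult_alphabet successively_append_iff successively_Cons
        hd_map last_map successively_map)
  then have "successively (\<lambda>y z. idx y \<noteq> idx z) (normal u @ normal [y, z] @ normal v)"
    by (simp add: successively_map del: map_append)
  moreover have "normal u \<in> reduced" "normal [y, z] \<in> reduced" "normal v \<in> reduced"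
    using alphabet by (auto intro: normal_reduced)
  ultimately have "normal u @ normal [y, z] @ normal v \<in> reduced"
    by (auto simp: reduced_def)
  moreover have "cong (u @ [y, z] @ v) (normal u @ normal [y, z] @ normal v)"
    using alphabet normal_lists by (intro word_cong_append cong_normal) auto
  ultimately show ?thesis
    using cong_normal_eq normal_id by fastforce
qed

end

section \<open>Trioids of normal forms and their universal property\<close>

definition class_rep :: "'a trioid \<Rightarrow> 'a \<Rightarrow> 'a" where
  "class_rep T x = (SOME y. y \<in> carrier T \<and>
     word_cong (Plain ` carrier T) (P_pairs T) [Plain x] [Plain y])"

text \<open>Congruent letters have the same set of candidates, hence the choice operator picks the
  same representative for them.\<close>

lemma trioid_family_single:
  fixes T :: "'a trioid"
  assumes "trioid T"
  shows "trioid_family {()} (\<lambda>_. T) (class_rep T)"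
proof -
  let ?cong = "word_cong (Plain ` carrier T) (P_pairs T)"
  have rep: "class_rep T x \<in> carrier T \<and> ?cong [Plain x] [Plain (class_rep T x)]" if "x \<in> carrier T" for x
    unfolding class_rep_def by (rule someI[of _ x]) (simp add: that word_cong.refl)
  have "class_rep T x = class_rep T y" if "?cong [Plain x] [Plain y]" for x y
  proof -
    have "?cong [Plain x] w \<longleftrightarrow> ?cong [Plain y] w" for w
      using that word_cong.sym word_cong.trans by blast
    then show ?thesis by (simp add: class_rep_def)
  qed
  with rep assms show ?thesis
    by (intro trioid_family.intro) (simp_all add: disjoint_family_on_def)
qed

text \<open>Each product is described by one normal form of a concatenation; the piecewise formulas
  for \<open>FP\<close> are brought to this shape at the end.\<close>

locale free_trioid = trioid_family I X nf
  for I :: "'i set" and X :: "'i \<Rightarrow> 'a trioid" and nf +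
  fixes T :: "'a letter list trioid" (structure)
  assumes carrier_eq: "carrier T = {w \<in> reduced. \<exists>y\<in>set w. is_dotted y}"
    and l_eq: "\<lbrakk>u \<in> carrier T; v \<in> carrier T\<rbrakk> \<Longrightarrow> u \<turnstile> v = normal (map undot u @ v)"
    and r_eq: "\<lbrakk>u \<in> carrier T; v \<in> carrier T\<rbrakk> \<Longrightarrow> u \<stileturn> v = normal (u @ map undot v)"
    and p_eq: "\<lbrakk>u \<in> carrier T; v \<in> carrier T\<rbrakk> \<Longrightarrow> u \<perp> v = normal (u @ v)"
begin

lemma carrier_lists: "w \<in> carrier T \<Longrightarrow> w \<in> lists (alphabet I X)"
  by (simp add: carrier_eq reduced_def)

lemma carrier_normal: "w \<in> carrier T \<Longrightarrow> normal w = w"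
  by (simp add: carrier_eq normal_id)

lemma normal_carrier:
  assumes "w \<in> lists (alphabet I X)" "\<exists>y\<in>set w. is_dotted y"
  shows "normal w \<in> carrier T"
  using assms cong_has_dotted[OF cong_normal[OF assms(1)]] normal_reduced by (simp add: carrier_eq)

lemma closed:
  assumes "u \<in> carrier T" "v \<in> carrier T"
  shows "u \<turnstile> v \<in> carrier T" "u \<stileturn> v \<in> carrier T" "u \<perp> v \<in> carrier T"
proof -
  have "u \<in> lists (alphabet I X)" "v \<in> lists (alphabet I X)"
    "\<exists>y\<in>set u. is_dotted y" "\<exists>y\<in>set v. is_dotted y"
    using assms carrier_lists by (auto simp: carrier_eq)
  then show "u \<turnstile> v \<in> carrier T" "u \<stileturn> v \<in> carrier T" "u \<perp> v \<in> carrier T"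
    using assms by (auto simp: l_eq r_eq p_eq intro!: normal_carrier)
qed

text \<open>By absorption, both sides of every axiom become the normal form of one concatenation of
  three words, some stripped of their dots. The two concatenations agree because removing dots is
  idempotent and respects concatenation; for example both a \<stileturn> (b \<turnstile> c) and a
  \<stileturn> (b \<stileturn> c) strip b and c.\<close>

lemma trioid_T: "trioid T"
proof -
  have absorb:
    "normal (normal u @ v) = normal (u @ v)" "normal (u @ normal v) = normal (u @ v)"
    "normal (map undot (normal u) @ v) = normal (map undot u @ v)"
    "normal (u @ map undot (normal v)) = normal (u @ map undot v)"
    if "set u \<subseteq> alphabet I X" "set v \<subseteq> alphabet I X" for u v
    using normal_absorb[of u v] that by (simp_all add: in_lists_conv_set subset_iff)
  have sub: "set u \<subseteq> alphabet I X" if "u \<in> carrier T" for u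
    using carrier_lists[OF that] by auto
  have undot: "undot ` A \<subseteq> alphabet I X \<longleftrightarrow> A \<subseteq> alphabet I X" for A
    by auto
  have products: "normal (map undot u @ v) \<in> carrier T" "normal (u @ map undot v) \<in> carrier T"
    "normal (u @ v) \<in> carrier T" if "u \<in> carrier T" "v \<in> carrier T" for u v
    using closed[OF that] that by (simp_all add: l_eq r_eq p_eq)
  show ?thesis
    by unfold_locales (simp_all add: l_eq r_eq p_eq products absorb sub undot o_def)
qed

lemma Dotted_carrier: "i \<in> I \<Longrightarrow> x \<in> carrier (X i) \<Longrightarrow> [Dotted x] \<in> carrier T"
  by (auto simp: carrier_eq reduced_def alphabet_def is_dotted_def)

lemma Dotted_hom:
  assumes i: "i \<in> I"
  shows "(\<lambda>x. [Dotted x]) \<in> trioid_hom (X i) T"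
proof -
  have "[Dotted (x \<turnstile>\<^bsub>X i\<^esub> y)] = [Dotted x] \<turnstile> [Dotted y] \<and>
      [Dotted (x \<stileturn>\<^bsub>X i\<^esub> y)] = [Dotted x] \<stileturn> [Dotted y] \<and>
      [Dotted (x \<perp>\<^bsub>X i\<^esub> y)] = [Dotted x] \<perp> [Dotted y]"
    if "x \<in> carrier (X i)" "y \<in> carrier (X i)" for x y
    using that i by (simp add: l_eq r_eq p_eq Dotted_carrier normal_pair_same)
  then show ?thesis
    by (simp add: trioid_hom_def Dotted_carrier[OF i] Pi_iff)
qed

text \<open>One-letter dotted words generate the trioid, which yields uniqueness of homomorphisms.
  The first letter is split off: if the tail still has a dot, the word is a product by \<perp> or
  \<turnstile>; if not, it is a product by \<stileturn>.\<close>

lemma carrier_induct [consumes 1, case_names single l p r]: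
  assumes "w \<in> carrier T"
    and single: "\<And>i x. i \<in> I \<Longrightarrow> x \<in> carrier (X i) \<Longrightarrow> P [Dotted x]"
    and l: "\<And>u v. u \<in> carrier T \<Longrightarrow> v \<in> carrier T \<Longrightarrow> P u \<Longrightarrow> P v \<Longrightarrow> P (u \<turnstile> v)"
    and p: "\<And>u v. u \<in> carrier T \<Longrightarrow> v \<in> carrier T \<Longrightarrow> P u \<Longrightarrow> P v \<Longrightarrow> P (u \<perp> v)"
    and r: "\<And>u v. u \<in> carrier T \<Longrightarrow> v \<in> carrier T \<Longrightarrow> P u \<Longrightarrow> P v \<Longrightarrow> P (u \<stileturn> v)"
  shows "P w"
  using assms(1)
proof (induction w rule: length_induct)
  case (1 w)
  then obtain y w' where w: "w = y # w'"
    by (cases w) (auto simp: carrier_eq)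
  with 1 have y: "y \<in> alphabet I X" and w': "w' \<in> reduced"
    by (auto simp: carrier_eq reduced_def successively_Cons)
  then obtain i x where x: "i \<in> I" "x \<in> carrier (X i)" "y \<in> {Plain x, Dotted x}"
    by (auto simp: alphabet_def)
  have Px: "P [Dotted x]" "[Dotted x] \<in> carrier T"
    using single x Dotted_carrier by auto
  have normal: "normal (y # w') = w"
    using carrier_normal 1(2) w by simp
  show ?case
  proof (cases "\<exists>z\<in>set w'. is_dotted z")
    case True
    with w' have T: "w' \<in> carrier T"
      by (simp add: carrier_eq)
    with 1(1) w have Pw: "P w'" by simp
    show ?thesis
    proof (cases "is_dotted y")
      case True
      then have "w = [Dotted x] \<perp> w'"
        using x normal by (auto simp: is_dotted_def p_eq[OF Px(2) T])
      with p[OF Px(2) T Px(1) Pw] show ?thesis by simp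
    next
      case False
      then have "w = [Dotted x] \<turnstile> w'"
        using x normal by (auto simp: is_dotted_def l_eq[OF Px(2) T])
      with l[OF Px(2) T Px(1) Pw] show ?thesis by simp
    qed
  next
    case False
    with 1(2) w have y': "y = Dotted x"
      using x by (auto simp: carrier_eq is_dotted_def)
    show ?thesis
    proof (cases w')
      case Nil
      with w y' Px show ?thesis by simp
    next
      case (Cons z w'')
      with False obtain t where z: "z = Plain t"
        by (cases z) (auto simp: is_dotted_def)
      \<comment> \<open>The tail has no dot and is not in the carrier. Dotting its first letter
        repairs this, and \<stileturn> removes the dot again.\<close>
      let ?v = "Dotted t # w''"
      have "undot u = u" if "u \<in> set w''" for u
        using False that Cons by (cases u) (auto simp: is_dotted_def)
      then have undot: "map undot ?v = w'"
        using Cons z by (simp add: map_idI)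
      have "idx (Dotted t) = idx z" "Dotted t \<in> alphabet I X \<longleftrightarrow> z \<in> alphabet I X"
        using idx_undot[of "Dotted t"] undot_alphabet[of "Dotted t"] z by simp_all
      then have v: "?v \<in> carrier T"
        using w' Cons z by (simp add: carrier_eq reduced_def successively_Cons is_dotted_def)
      with 1(1) w Cons have "P ?v" by simp
      moreover have "w = [Dotted x] \<stileturn> ?v"
        using normal y' undot by (simp add: r_eq[OF Px(2) v])
      ultimately show ?thesis
        using r[OF Px(2) v Px(1)] by simp
    qed
  qed
qed

lemma hom_unique:
  assumes "f \<in> trioid_hom T T'" "g \<in> trioid_hom T T'"
    and "\<And>i x. i \<in> I \<Longrightarrow> x \<in> carrier (X i) \<Longrightarrow> f [Dotted x] = g [Dotted x]"
    and "w \<in> carrier T"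
  shows "f w = g w"
  using assms(4)
  by (induction rule: carrier_induct) (use assms(1-3) in \<open>auto simp: trioid_hom_def\<close>)

text \<open>The homomorphisms \<open>\<phi> i\<close> carry relations of \<open>X i\<close> to
  relations of \<open>T'\<close>, so the letterwise map \<open>L\<close> respects congruence. The
  value of \<open>\<eta>\<close> is the single dotted letter to which the image word
  reduces.\<close>

lemma hom_exists:
  fixes T' :: "'c trioid"
  assumes T': "trioid T'" and \<phi>: "\<And>i. i \<in> I \<Longrightarrow> \<phi> i \<in> trioid_hom (X i) T'"
  shows "\<exists>\<eta>. \<eta> \<in> trioid_hom T T' \<and> (\<forall>i\<in>I. \<forall>x\<in>carrier (X i). \<eta> [Dotted x] = \<phi> i x)"
proof -
  interpret E: trioid_family "{()}" "\<lambda>_. T'" "class_rep T'"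
    by (rule trioid_family_single[OF T'])
  define L where "L y = (case y of Plain x \<Rightarrow> Plain (\<phi> (idx y) x) | Dotted x \<Rightarrow> Dotted (\<phi> (idx y) x))" for y
  define \<eta> where "\<eta> w = base (hd (E.normal (map L w)))" for w
  have L: "L (Plain x) = Plain (\<phi> i x)" "L (Dotted x) = Dotted (\<phi> i x)"
    if "i \<in> I" "x \<in> carrier (X i)" for i x
    using that by (simp_all add: L_def idx_eq)
  have L_undot: "L (undot y) = undot (L y)" for y
    by (cases y) (simp_all add: L_def ind_def)
  have \<phi>_closed: "\<phi> i x \<in> carrier T'" if "i \<in> I" "x \<in> carrier (X i)" for i x
    using \<phi>[OF that(1)] that(2) by (auto simp: trioid_hom_def)
  have L_alphabet: "L ` alphabet I X \<subseteq> alphabet {()} (\<lambda>_. T')"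
    using L \<phi>_closed by (auto simp: alphabet_def)
  have L_lists: "map L w \<in> lists (alphabet {()} (\<lambda>_. T'))" if "w \<in> lists (alphabet I X)" for w
    using that L_alphabet by (auto simp: image_subset_iff)
  have L_relations: "(map L a, map L b) \<in> E.relations" if "(a, b) \<in> relations" for a b
  proof -
    obtain i where i: "i \<in> I" "(a, b) \<in> Q_pairs (X i) \<union> P_pairs (X i)"
      using \<open>(a, b) \<in> relations\<close> by blast
    interpret trioid "X i" by (rule trioids[OF i(1)])
    have hom: "\<phi> i (x \<turnstile>\<^bsub>X i\<^esub> y) = \<phi> i x \<turnstile>\<^bsub>T'\<^esub> \<phi> i y" "\<phi> i (x \<stileturn>\<^bsub>X i\<^esub> y) = \<phi> i x \<stileturn>\<^bsub>T'\<^esub> \<phi> i y"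
      "\<phi> i (x \<perp>\<^bsub>X i\<^esub> y) = \<phi> i x \<perp>\<^bsub>T'\<^esub> \<phi> i y" if "x \<in> carrier (X i)" "y \<in> carrier (X i)" for x y
      using \<phi>[OF i(1)] that by (auto simp: trioid_hom_def)
    have "(map L a, map L b) \<in> Q_pairs T' \<union> P_pairs T'"
      using i(2) unfolding P_pairs_def[of "X i"] Q_pairs_def[of "X i"]
      by (auto simp: L[OF i(1)] hom l_closed r_closed p_closed P_pairsI Q_pairsI \<phi>_closed[OF i(1)])
    then show ?thesis by simp
  qed
  have L_cong: "E.cong (map L w) (map L w')" if "cong w w'" for w w'
    using that L_alphabet
  proof (rule word_cong_map)
    fix a b assume "(a, b) \<in> relations"
    from word_cong.step[OF L_relations[OF this], of "[]" _ "[]"] show "E.cong (map L a) (map L b)"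
      by simp
  qed
  have L_normal: "E.normal (map L (normal w)) = E.normal (map L w)" if "w \<in> lists (alphabet I X)" for w
    using E.cong_normal_eq[OF L_cong[OF cong_normal[OF that]]] by simp
  have \<eta>: "E.normal (map L w) = [Dotted (\<eta> w)] \<and> \<eta> w \<in> carrier T'" if w: "w \<in> carrier T" for w
  proof -
    let ?v = "E.normal (map L w)"
    note w_lists = L_lists[OF carrier_lists[OF w]]
    have "\<exists>y\<in>set w. is_dotted y"
      using w by (simp add: carrier_eq)
    then have "\<exists>y\<in>set (map L w). is_dotted y"
      by (force simp: is_dotted_def L_def)
    then have "\<exists>y\<in>set ?v. is_dotted y"
      using E.cong_has_dotted[OF E.cong_normal[OF w_lists]] by simp
    moreover have "?v \<in> E.reduced"
      using E.normal_reduced[OF w_lists] .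
    \<comment> \<open>All letters over \<open>T'\<close> share one index, so an alternating word has
      at most one letter; the dot that survives forces exactly one, and it is dotted.\<close>
    ultimately obtain t where "?v = [Dotted t]" "t \<in> carrier T'"
      by (cases ?v rule: remdups_adj.cases) (auto simp: E.reduced_def is_dotted_def alphabet_def)
    then show ?thesis
      by (simp add: \<eta>_def)
  qed
  have \<eta>_Dotted: "\<eta> [Dotted x] = \<phi> i x" if "i \<in> I" "x \<in> carrier (X i)" for i x
    using that by (simp add: \<eta>_def L E.normal_def E.act_def)
  \<comment> \<open>\<open>f\<close> and \<open>f'\<close> are the same operation, identity or dot
    removal, on words over the family and on words over \<open>T'\<close>; likewise \<open>g\<close>
    and \<open>g'\<close>.\<close>
  have \<eta>_normal: "\<eta> (normal (f u @ g v)) = base (hd (E.normal (f' [Dotted (\<eta> u)] @ g' [Dotted (\<eta> v)])))"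
    if uv: "u \<in> carrier T" "v \<in> carrier T"
      and f: "(f, f') = (id, id) \<or> (f, f') = (map undot, map undot)"
      and g: "(g, g') = (id, id) \<or> (g, g') = (map undot, map undot)" for u v f g f' g'
  proof -
    note lists = carrier_lists[OF uv(1)] carrier_lists[OF uv(2)]
    have "f u @ g v \<in> lists (alphabet I X)"
      using lists f g by auto
    moreover have "map L (f u @ g v) = f' (map L u) @ g' (map L v)"
      using f g by (auto simp: L_undot)
    moreover have "E.normal (f' (E.normal (map L u)) @ g' (E.normal (map L v))) =
        E.normal (f' (map L u) @ g' (map L v))"
      by (rule E.normal_append_normal) (use lists[THEN L_lists] f g in auto)
    ultimately show ?thesis
      using \<eta>[OF uv(1)] \<eta>[OF uv(2)]
      by (simp add: \<eta>_def[of "normal _"] L_normal del: map_append in_lists_conv_set)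
  qed
  have "\<eta> \<in> trioid_hom T T'"
    unfolding trioid_hom_def
  proof (clarsimp, intro conjI ballI)
    show "\<eta> \<in> carrier T \<rightarrow> carrier T'"
      using \<eta> by simp
    fix u v assume uv: "u \<in> carrier T" "v \<in> carrier T"
    note * = \<eta>[OF uv(1)] \<eta>[OF uv(2)]
    show "\<eta> (u \<turnstile> v) = \<eta> u \<turnstile>\<^bsub>T'\<^esub> \<eta> v"
      using \<eta>_normal[OF uv, of "map undot" "map undot" id id] *
      by (simp add: l_eq[OF uv] E.normal_pair_same)
    show "\<eta> (u \<stileturn> v) = \<eta> u \<stileturn>\<^bsub>T'\<^esub> \<eta> v"
      using \<eta>_normal[OF uv, of id id "map undot" "map undot"] *
      by (simp add: r_eq[OF uv] E.normal_pair_same)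
    show "\<eta> (u \<perp> v) = \<eta> u \<perp>\<^bsub>T'\<^esub> \<eta> v"
      using \<eta>_normal[OF uv, of id id id id] * by (simp add: p_eq[OF uv] E.normal_pair_same)
  qed
  with \<eta>_Dotted show ?thesis by blast
qed

theorem free_product: "is_free_product TYPE('c) I X T (\<lambda>i x. [Dotted x])"
  unfolding is_free_product_def
proof (intro conjI ballI allI impI)
  fix T' :: "'c trioid" and \<phi>
  assume T': "trioid T'" and "\<forall>i\<in>I. \<phi> i \<in> trioid_hom (X i) T'"
  then obtain \<eta> where \<eta>: "\<eta> \<in> trioid_hom T T'" "\<forall>i\<in>I. \<forall>x\<in>carrier (X i). \<eta> [Dotted x] = \<phi> i x"
    using hom_exists by blast
  show "\<exists>!\<eta>. \<eta> \<in> extensional (carrier T) \<and> \<eta> \<in> trioid_hom T T' \<and>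
      (\<forall>i\<in>I. \<forall>x\<in>carrier (X i). \<eta> [Dotted x] = \<phi> i x)"
  proof (rule ex1I[of _ "restrict \<eta> (carrier T)"], intro conjI)
    show "restrict \<eta> (carrier T) \<in> trioid_hom T T'"
      using \<eta>(1) closed by (auto simp: trioid_hom_def)
    show "\<forall>i\<in>I. \<forall>x\<in>carrier (X i). restrict \<eta> (carrier T) [Dotted x] = \<phi> i x"
      using \<eta>(2) Dotted_carrier by simp
  next
    fix \<theta>
    assume \<theta>: "\<theta> \<in> extensional (carrier T) \<and> \<theta> \<in> trioid_hom T T' \<and>
      (\<forall>i\<in>I. \<forall>x\<in>carrier (X i). \<theta> [Dotted x] = \<phi> i x)"
    show "\<theta> = restrict \<eta> (carrier T)"
    proof (rule extensionalityI[of _ "carrier T"])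
      fix w assume "w \<in> carrier T"
      with hom_unique[of \<theta> T' \<eta> w] \<theta> \<eta> show "\<theta> w = restrict \<eta> (carrier T) w" by simp
    qed (use \<theta> in auto)
  qed simp
qed (auto simp: trioid_T Dotted_hom inj_on_def)

end

section \<open>Normal forms from Groebner-Shirshov bases\<close>

locale gsb_family =
  fixes I :: "'i set"
    and X :: "'i \<Rightarrow> 'a trioid"
    and rI :: "('i \<times> 'i) set"
    and rX :: "'i \<Rightarrow> ('a \<times> 'a) set"
    and R :: "'i \<Rightarrow> ('a letter list \<Rightarrow>\<^sub>0 'k::field) set"
  assumes trioids: "\<And>i. i \<in> I \<Longrightarrow> trioid (X i)"
    and disjoint: "disjoint_family_on (\<lambda>i. carrier (X i)) I"
    and well_order_I: "well_order_on I rI"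
    and well_order_X: "\<And>i. i \<in> I \<Longrightarrow> well_order_on (carrier (X i)) (rX i)"
    and basis: "\<And>i. i \<in> I \<Longrightarrow>
           groebner_shirshov_basis (word_less I X rI rX) (Plain ` carrier (X i))
             (genideal (free_alg (Plain ` carrier (X i))) (P_rel (X i))) (R i)"
    and P_subset: "\<And>i. i \<in> I \<Longrightarrow> P_rel (X i) \<subseteq> R i"
begin

abbreviation less :: "('a letter list \<times> 'a letter list) set" where
  "less \<equiv> word_less I X rI rX"

abbreviation lm :: "('a letter list \<Rightarrow>\<^sub>0 'k) \<Rightarrow> 'a letter list" where
  "lm \<equiv> leading_monomial less"

abbreviation plain_cong :: "'i \<Rightarrow> 'a letter list \<Rightarrow> 'a letter list \<Rightarrow> bool" where
  "plain_cong i \<equiv> word_cong (Plain ` carrier (X i)) (P_pairs (X i))"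

abbreviation normals :: "'i \<Rightarrow> 'a letter set" where
  "normals \<equiv> normal_letters I X rI rX R"

section \<open>The order on words\<close>

lemma index_unique:
  "i \<in> I \<Longrightarrow> j \<in> I \<Longrightarrow> x \<in> carrier (X i) \<Longrightarrow> x \<in> carrier (X j) \<Longrightarrow> i = j"
  using disjoint by (auto simp: disjoint_family_on_def)

lemma order_I: "trans rI" "antisym rI" "total_on I rI"
  using well_order_I
  by (auto simp: well_order_on_def linear_order_on_def partial_order_on_def preorder_on_def)

lemma order_X:
  assumes "i \<in> I"
  shows "trans (rX i)" "antisym (rX i)" "total_on (carrier (X i)) (rX i)"
  using well_order_X[OF assms]
  by (auto simp: well_order_on_def linear_order_on_def partial_order_on_def preorder_on_def)

lemma base_less_same:
  assumes "i \<in> I" "x \<in> carrier (X i)" "y \<in> carrier (X i)"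
  shows "(x, y) \<in> base_less I X rI rX \<longleftrightarrow> x \<noteq> y \<and> (x, y) \<in> rX i"
  using assms index_unique unfolding base_less_def by blast

lemma trans_base_less: "trans (base_less I X rI rX)"
proof (rule transI)
  fix x y z assume xy: "(x, y) \<in> base_less I X rI rX" and yz: "(y, z) \<in> base_less I X rI rX"
  obtain i j where i: "i \<in> I" "j \<in> I" "x \<in> carrier (X i)" "y \<in> carrier (X j)"
    "i \<noteq> j \<and> (i, j) \<in> rI \<or> i = j \<and> x \<noteq> y \<and> (x, y) \<in> rX i"
    using xy unfolding base_less_def by blast
  obtain j' k where k: "j' \<in> I" "k \<in> I" "y \<in> carrier (X j')" "z \<in> carrier (X k)"
    "j' \<noteq> k \<and> (j', k) \<in> rI \<or> j' = k \<and> y \<noteq> z \<and> (y, z) \<in> rX j'"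
    using yz unfolding base_less_def by blast
  have j: "j' = j"
    using index_unique i k by blast
  have "i \<noteq> k \<and> (i, k) \<in> rI \<or> i = k \<and> x \<noteq> z \<and> (x, z) \<in> rX i"
    using i(5) k(5) transD[OF order_I(1)] antisymD[OF order_I(2)]
      transD[OF order_X(1)[OF i(1)]] antisymD[OF order_X(2)[OF i(1)]] unfolding j by blast
  then show "(x, z) \<in> base_less I X rI rX"
    unfolding base_less_def using i k by blast
qed

lemma total_base_less: "total_on (\<Union>i\<in>I. carrier (X i)) (base_less I X rI rX)"
proof (rule total_onI)
  fix x y assume "x \<in> (\<Union>i\<in>I. carrier (X i))" "y \<in> (\<Union>i\<in>I. carrier (X i))" and xy: "x \<noteq> y"
  then obtain i j where ij: "i \<in> I" "j \<in> I" "x \<in> carrier (X i)" "y \<in> carrier (X j)"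
    by blast
  show "(x, y) \<in> base_less I X rI rX \<or> (y, x) \<in> base_less I X rI rX"
  proof (cases "i = j")
    case True
    with ij xy have "(x, y) \<in> rX i \<or> (y, x) \<in> rX i"
      using order_X(3)[OF ij(1)] by (auto simp: total_on_def)
    with True ij xy show ?thesis
      by (auto simp: base_less_same)
  next
    case False
    with ij have "(i, j) \<in> rI \<or> (j, i) \<in> rI"
      using order_I(3) by (auto simp: total_on_def)
    with False ij show ?thesis
      unfolding base_less_def by blast
  qed
qed

lemma trans_less: "trans less"
  unfolding word_less_def
proof (rule lenlex_transI, rule transI)
  fix x y z assume "(x, y) \<in> letter_less I X rI rX" "(y, z) \<in> letter_less I X rI rX"
  then show "(x, z) \<in> letter_less I X rI rX"
    using transD[OF trans_base_less] unfolding letter_less_def base_less_def by blast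
qed

lemma irrefl_less: "irrefl less"
  unfolding word_less_def irrefl_def
  using index_unique by (auto intro!: lenlex_irreflexive simp: letter_less_def base_less_def)

lemma total_less: "total_on (lists (alphabet I X)) less"
  unfolding word_less_def
proof (rule total_on_lists_lenlex)
  show "total_on (alphabet I X) (letter_less I X rI rX)"
    using total_base_less unfolding total_on_def letter_less_def alphabet_def by blast
qed

text \<open>The order compares lengths first, so the two-letter word leads whatever the letters
  are.\<close>

lemma lm_relation: "lm (word_poly [x, y] - word_poly [z]) = [x, y]"
proof (rule leading_monomial_eqI[OF trans_less irrefl_less])
  have keys: "Poly_Mapping.keys (word_poly [x, y] - word_poly [z] :: 'a letter list \<Rightarrow>\<^sub>0 'k) = {[x, y], [z]}"
    by (auto simp: in_keys_iff lookup_minus lookup_single when_def split: if_splits)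
  show "[x, y] \<in> Poly_Mapping.keys (word_poly [x, y] - word_poly [z] :: 'a letter list \<Rightarrow>\<^sub>0 'k)"
    by (simp add: keys)
  show "(v, [x, y]) \<in> less"
    if "v \<in> Poly_Mapping.keys (word_poly [x, y] - word_poly [z] :: 'a letter list \<Rightarrow>\<^sub>0 'k)" "v \<noteq> [x, y]" for v
    using that by (simp add: keys word_less_def lenlex_conv)
qed

section \<open>Normal letters as class representatives\<close>

lemma P_pairs_lists:
  "i \<in> I \<Longrightarrow> P_pairs (X i) \<subseteq> lists (Plain ` carrier (X i)) \<times> lists (Plain ` carrier (X i))"
  by (rule trioid.P_pairs_lists[OF trioids])

text \<open>Elements of \<open>R i\<close> need not be differences of words; they are controlled
  through their coefficient sums over closed sets.\<close>

lemma mass_basis: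
  assumes "i \<in> I" "s \<in> R i" "cong_closed (Plain ` carrier (X i)) (P_pairs (X i)) W"
  shows "mass W s = 0"
proof (rule mass_genideal[OF P_pairs_lists[OF assms(1)] _ assms(3)])
  interpret ring "free_alg (Plain ` carrier (X i)) :: ('a letter list \<Rightarrow>\<^sub>0 'k) ring"
    by (rule ring_free_alg)
  have "R i \<subseteq> genideal (free_alg (Plain ` carrier (X i))) (R i)"
    using basis[OF assms(1)] by (intro genideal_self) (simp add: groebner_shirshov_basis_def)
  then show "s \<in> genideal (free_alg (Plain ` carrier (X i))) (binomials (P_pairs (X i)))"
    using basis[OF assms(1)] assms(2) by (auto simp: groebner_shirshov_basis_def P_rel_eq_binomials)
qed

lemma basis_lm:
  assumes "i \<in> I" "s \<in> R i"
  shows "lm s \<in> Poly_Mapping.keys s" "lm s \<in> lists (Plain ` carrier (X i))"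
    "v \<in> Poly_Mapping.keys s \<Longrightarrow> v \<noteq> lm s \<Longrightarrow> (v, lm s) \<in> less" "lm s \<noteq> []"
proof -
  have s: "s \<in> carrier (free_alg (Plain ` carrier (X i)))" "s \<noteq> 0"
    using basis[OF assms(1)] assms(2) by (auto simp: groebner_shirshov_basis_def)
  have "Plain ` carrier (X i) \<subseteq> alphabet I X"
    using assms(1) by (auto simp: alphabet_def)
  then have "total_on (lists (Plain ` carrier (X i))) less"
    using total_less total_on_subset lists_mono by metis
  note lm = leading_monomial_greatest[OF trans_less irrefl_less this s]
  show key: "lm s \<in> Poly_Mapping.keys s"
    and less: "v \<in> Poly_Mapping.keys s \<Longrightarrow> v \<noteq> lm s \<Longrightarrow> (v, lm s) \<in> less" for v
    using lm by blast+
  show "lm s \<in> lists (Plain ` carrier (X i))"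
    using s key by (auto simp: free_alg_def)
  \<comment> \<open>No word is below \<open>[]\<close>, so otherwise \<open>s\<close> would be a
    nonzero constant. But the set containing only \<open>[]\<close> is closed under congruence, and
    the coefficient sum over it must vanish.\<close>
  show "lm s \<noteq> []"
  proof
    assume "lm s = []"
    then have "Poly_Mapping.keys s = {[]}"
      using key less by (auto simp: word_less_def)
    moreover have "mass {[]} s = 0"
      using trioid.plain_cong_Nil[OF trioids[OF assms(1)]]
      by (intro mass_basis[OF assms]) (auto simp: cong_closed_def)
    ultimately show False
      by (auto simp: mass_def in_keys_iff)
  qed
qed

lemma normals_iff:
  "Plain x \<in> normals i \<longleftrightarrow> x \<in> carrier (X i) \<and> (\<forall>s\<in>R i. lm s \<noteq> [Plain x])"
  by (auto simp: normal_letters_def) (metis imageI)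

text \<open>
  The least letter \<open>m\<close> congruent to \<open>x\<close> is normal: otherwise it is the leading monomial of some
  \<open>s \<in> R i\<close>, and then no other word of \<open>s\<close> is congruent to \<open>m\<close>, so the coefficients of \<open>s\<close> over the
  congruence class of \<open>m\<close> do not sum to \<open>0\<close>.
\<close>

lemma ex_normal:
  assumes i: "i \<in> I" and x: "x \<in> carrier (X i)"
  shows "\<exists>m\<in>carrier (X i). Plain m \<in> normals i \<and> plain_cong i [Plain x] [Plain m]"
proof -
  let ?A = "{m \<in> carrier (X i). plain_cong i [Plain x] [Plain m]}"
  have "wf (rX i - Id)"
    using well_order_X[OF i] by (simp add: well_order_on_def)
  moreover have "x \<in> ?A"
    using x by (simp add: word_cong.refl)
  ultimately obtain m where m: "m \<in> ?A" "\<And>y. (y, m) \<in> rX i - Id \<Longrightarrow> y \<notin> ?A"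
    using wf_eq_minimal by (metis (no_types, lifting))
  have "lm s \<noteq> [Plain m]" if s: "s \<in> R i" for s
  proof
    assume lm: "lm s = [Plain m]"
    let ?W = "{w. plain_cong i [Plain m] w}"
    \<comment> \<open>A smaller word congruent to \<open>[Plain m]\<close> is nonempty and no longer
      than one letter, hence a letter below \<open>m\<close>, against the minimality of
      \<open>m\<close>.\<close>
    have "v = [Plain m]" if v: "v \<in> Poly_Mapping.keys s" "v \<in> ?W" for v
    proof (rule ccontr)
      assume "v \<noteq> [Plain m]"
      then have less: "(v, [Plain m]) \<in> less"
        using basis_lm(3)[OF i s v(1)] lm by simp
      have "v \<noteq> []"
        using trioid.plain_cong_Nil[OF trioids[OF i], of "[Plain m]" v] v(2) by auto
      moreover have "length v \<le> 1"
        using lenlex_length[of v "[Plain m]"] less by (simp add: word_less_def)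
      ultimately obtain y where y: "v = [y]"
        by (cases v) auto
      have "v \<in> lists (Plain ` carrier (X i))"
        using basis[OF i] s v(1) by (auto simp: groebner_shirshov_basis_def free_alg_def)
      with y obtain a where a: "v = [Plain a]" "a \<in> carrier (X i)"
        by auto
      then have "(a, m) \<in> rX i - Id"
        using less m(1) base_less_same[OF i]
        by (auto simp: word_less_def letter_less_def Cons_lenlex_iff)
      moreover have "plain_cong i [Plain x] [Plain a]"
        using m(1) v(2) a(1) by (auto intro: word_cong.trans)
      ultimately show False
        using m(2) a(2) by blast
    qed
    then have "mass ?W s = (\<Sum>w\<in>{[Plain m]}. if w \<in> ?W then Poly_Mapping.lookup s w else 0)"
      unfolding mass_def using basis_lm(1)[OF i s] lm by (intro sum.mono_neutral_right) auto
    also have "\<dots> = Poly_Mapping.lookup s [Plain m]"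
      by (simp add: word_cong.refl)
    also have "\<dots> \<noteq> 0"
      using basis_lm(1)[OF i s] lm by (simp add: in_keys_iff)
    finally show False
      using mass_basis[OF i s, of ?W] by (auto simp: cong_closed_def intro: word_cong.trans)
  qed
  with m(1) show ?thesis
    by (auto simp: normals_iff)
qed

text \<open>For distinct congruent letters the difference lies in the ideal, and its leading
  monomial is the larger letter. Some leading monomial of the basis is a nonempty factor of this
  one-letter word, so it equals that letter, which is then not normal. Totality of
  \<open>rX i\<close> and symmetry of congruence allow either letter to be the larger one.\<close>

lemma normal_unique:
  assumes i: "i \<in> I" and m: "Plain m \<in> normals i" "Plain n \<in> normals i"
    and cong: "plain_cong i [Plain m] [Plain n]"
  shows "m = n"
proof -
  have False if m: "Plain m \<in> normals i" "Plain n \<in> normals i"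
    and cong: "plain_cong i [Plain m] [Plain n]" and mn: "m \<noteq> n" "(n, m) \<in> rX i" for m n
  proof -
    let ?f = "word_poly [Plain m] - word_poly [Plain n] :: 'a letter list \<Rightarrow>\<^sub>0 'k"
    have mn': "m \<in> carrier (X i)" "n \<in> carrier (X i)"
      using m by (auto simp: normals_iff)
    have keys: "Poly_Mapping.keys ?f = {[Plain m], [Plain n]}"
      using mn by (auto simp: in_keys_iff lookup_minus lookup_single when_def split: if_splits)
    have "lm ?f = [Plain m]"
      by (rule leading_monomial_eqI[OF trans_less irrefl_less])
        (use mn mn' base_less_same[OF i] in \<open>auto simp: keys word_less_def letter_less_def Cons_lenlex_iff\<close>)
    moreover have "?f \<in> genideal (free_alg (Plain ` carrier (X i))) (P_rel (X i))"
      unfolding P_rel_eq_binomials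
      by (subst word_poly_diff_mem_genideal_iff[OF P_pairs_lists[OF i]]) (use mn' cong in auto)
    moreover have "?f \<noteq> 0"
      using keys by (metis insert_not_empty keys_zero)
    ultimately obtain s where s: "s \<in> R i" "sublist (lm s) [Plain m]"
      using basis[OF i] unfolding groebner_shirshov_basis_def by metis
    then have "lm s = [Plain m]"
      using basis_lm(4)[OF i s(1)] by (auto simp: sublist_Cons_right prefix_Cons)
    with s m show False
      by (auto simp: normals_iff)
  qed
  moreover have "m \<in> carrier (X i)" "n \<in> carrier (X i)"
    using m by (auto simp: normals_iff)
  ultimately show ?thesis
    using m cong order_X(3)[OF i] word_cong.sym[OF cong] unfolding total_on_def by metis
qed

text \<open>The index is bound inside the choice so that one function serves the whole family;
  disjointness determines it from \<open>x\<close>.\<close>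

definition rep :: "'a \<Rightarrow> 'a" where
  "rep x = (SOME m. \<exists>i\<in>I. x \<in> carrier (X i) \<and> Plain m \<in> normals i \<and>
     plain_cong i [Plain x] [Plain m])"

lemma rep:
  assumes "i \<in> I" "x \<in> carrier (X i)"
  shows "Plain (rep x) \<in> normals i" "plain_cong i [Plain x] [Plain (rep x)]" "rep x \<in> carrier (X i)"
proof -
  have "\<exists>j\<in>I. x \<in> carrier (X j) \<and> Plain (rep x) \<in> normals j \<and> plain_cong j [Plain x] [Plain (rep x)]"
    unfolding rep_def by (rule someI_ex) (use ex_normal[OF assms] assms in blast)
  then show "Plain (rep x) \<in> normals i" "plain_cong i [Plain x] [Plain (rep x)]"
    using index_unique assms by blast+
  then show "rep x \<in> carrier (X i)"
    by (simp add: normals_iff)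
qed

sublocale trioid_family I X rep
proof (rule trioid_family.intro)
  fix i x y assume i: "i \<in> I" and xy: "x \<in> carrier (X i)" "y \<in> carrier (X i)"
    and cong: "plain_cong i [Plain x] [Plain y]"
  have "plain_cong i [Plain (rep x)] [Plain (rep y)]"
    using rep(2)[OF i xy(1)] rep(2)[OF i xy(2)] cong word_cong.sym word_cong.trans by blast
  then show "rep x = rep y"
    using normal_unique i rep xy by blast
qed (erule trioids | rule disjoint | erule (1) rep)+

lemma rep_eq_iff:
  assumes "i \<in> I" "x \<in> carrier (X i)"
  shows "rep x = x \<longleftrightarrow> Plain x \<in> normals i"
proof
  assume "Plain x \<in> normals i"
  then show "rep x = x"
    using normal_unique[OF assms(1) _ rep(1)[OF assms] rep(2)[OF assms]] by simp
qed (use rep(1)[OF assms] in simp)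

section \<open>Irreducible words and the trioid \<open>FP\<close>\<close>

lemma Y3_iff: "y \<in> Y3 I X rI rX R \<longleftrightarrow> y \<in> alphabet I X \<and> letter_norm rep y = y"
proof (cases y)
  case (Plain x)
  have "Plain x \<in> normals i \<longleftrightarrow> x \<in> carrier (X i) \<and> rep x = x" if "i \<in> I" for i
    using that rep_eq_iff normals_iff by blast
  then show ?thesis
    unfolding Plain Y3_def alphabet_def by auto
qed (auto simp: Y3_def alphabet_def normal_letters_def)

text \<open>Two adjacent letters of equal index form the leading monomial of a relation in
  \<open>Q_rel\<close> or in \<open>P_rel\<close>, and the latter is contained in the basis.
  Conversely, a leading monomial from \<open>R i\<close> is a letter that is not normal or starts
  with two letters of index \<open>i\<close>; neither occurs in a reduced word.\<close>

lemma irreducible_iff: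
  assumes "v \<in> lists (alphabet I X)"
  shows "(\<forall>s\<in>(\<Union>i\<in>I. Q_rel (X i) \<union> R i). \<not> sublist (lm s) v) \<longleftrightarrow> v \<in> reduced" (is "?L \<longleftrightarrow> _")
proof
  assume irred: ?L
  have "letter_norm rep y = y" if "y \<in> set v" for y
  proof (cases y)
    case (Plain x)
    have "y \<in> alphabet I X"
      using that assms by auto
    with Plain obtain i where i: "i \<in> I" "x \<in> carrier (X i)"
      by (auto simp: alphabet_def)
    have sub: "sublist [Plain x] v"
      using that unfolding Plain by (metis append_Cons append_Nil in_set_conv_decomp sublist_def)
    have "lm s \<noteq> [Plain x]" if "s \<in> R i" for s
    proof -
      have "s \<in> (\<Union>i\<in>I. Q_rel (X i) \<union> R i)"
        using i(1) that by blast
      with irred have "\<not> sublist (lm s) v" by blast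
      with sub show ?thesis by metis
    qed
    with i(2) have "Plain x \<in> normals i"
      by (simp add: normals_iff)
    with i show ?thesis
      by (simp add: Plain rep_eq_iff)
  qed simp
  moreover have "successively (\<lambda>y z. idx y \<noteq> idx z) v"
  proof -
    have "idx y \<noteq> idx z" if v: "v = u @ [y, z] @ w" for u y z w
    proof
      assume idx: "idx y = idx z"
      have yz: "idx z \<in> I" "y \<in> letters (idx z)" "z \<in> letters (idx z)"
        using idx alphabet_iff[THEN iffD1, of y] alphabet_iff[THEN iffD1, of z] assms unfolding v
        by (simp_all del: Un_iff)
      from mult_relation[OF this] obtain c
        where "([y, z], [c]) \<in> Q_pairs (X (idx z)) \<union> P_pairs (X (idx z))" by blast
      then have "word_poly [y, z] - word_poly [c] \<in> Q_rel (X (idx z)) \<union> P_rel (X (idx z))"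
        unfolding Q_rel_eq_binomials P_rel_eq_binomials binomials_def by force
      then have "word_poly [y, z] - word_poly [c] \<in> (\<Union>i\<in>I. Q_rel (X i) \<union> R i)"
        using yz(1) P_subset by blast
      with irred have "\<not> sublist (lm (word_poly [y, z] - word_poly [c])) v"
        by blast
      then show False
        unfolding lm_relation v by (simp only: sublist_appendI not_True_eq_False)
    qed
    then show ?thesis
    proof (induction v)
      case (Cons y v)
      have "idx a \<noteq> idx b" if "v = u @ [a, b] @ w" for u a b w
        using Cons.prems[of "y # u" a b w] that by simp
      moreover have "idx y \<noteq> idx (hd v)" if "v \<noteq> []"
        using Cons.prems[of "[]" y "hd v" "tl v"] that by simp
      ultimately show ?case
        using Cons.IH unfolding successively_Cons by blast
    qed simp
  qed
  ultimately show "v \<in> reduced"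
    using assms by (simp add: reduced_def)
next
  assume v: "v \<in> reduced"
  have pair: False if yz: "sublist (y # z # w) v" "i \<in> I" "y \<in> letters i" "z \<in> letters i" for y z w i
  proof -
    obtain p q where "v = p @ (y # z # w) @ q"
      using yz(1) by (auto simp: sublist_def)
    with v have "idx y \<noteq> idx z"
      by (simp add: reduced_def successively_append_iff)
    with letters_idx[OF yz(2,3)] letters_idx[OF yz(2,4)] show False by simp
  qed
  show ?L
  proof (intro ballI notI)
    fix s assume "s \<in> (\<Union>i\<in>I. Q_rel (X i) \<union> R i)" and sub: "sublist (lm s) v"
    then obtain i where i: "i \<in> I" "s \<in> Q_rel (X i) \<or> s \<in> R i" by blast
    from i(2) show False
    proof
      assume "s \<in> Q_rel (X i)"
      then obtain y z c where s: "s = word_poly [y, z] - word_poly [c]"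
        and yz: "y \<in> letters i" "z \<in> letters i"
        unfolding Q_rel_def by blast
      from sub show False
        unfolding s lm_relation using i(1) yz by (rule pair)
    next
      assume s: "s \<in> R i"
      show False
      proof (cases "lm s" rule: remdups_adj.cases)
        case 1
        with basis_lm(4)[OF i(1) s] show False by simp
      next
        case (2 y)
        then obtain x where x: "y = Plain x" "x \<in> carrier (X i)"
          using basis_lm(2)[OF i(1) s] by auto
        then have "Plain x \<notin> normals i"
          using 2 s by (auto simp: normals_iff)
        moreover have "y \<in> set v"
          using sub 2 by (auto simp: sublist_def)
        ultimately show False
          using v x rep_eq_iff[OF i(1) x(2)] by (auto simp: reduced_def)
      next
        case (3 y z w)
        then show False
          using basis_lm(2)[OF i(1) s] pair[OF _ i(1), of y z w] sub by auto
      qed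
    qed
  qed
qed

text \<open>Membership in the ideal is congruence and irreducibility is being reduced, so the
  description defining \<open>NF\<close> singles out the unique reduced word congruent to
  \<open>w\<close>.\<close>

lemma NF_eq_normal:
  assumes w: "w \<in> lists (alphabet I X)"
  shows "NF I X rI rX R w = normal w"
proof -
  have ideal: "word_poly w - word_poly v \<in> genideal (free_alg (alphabet I X))
      (\<Union>i\<in>I. Q_rel (X i) \<union> P_rel (X i) :: ('a letter list \<Rightarrow>\<^sub>0 'k) set) \<longleftrightarrow> cong w v" for v
  proof -
    have "(\<Union>i\<in>I. Q_rel (X i) \<union> P_rel (X i) :: ('a letter list \<Rightarrow>\<^sub>0 'k) set) = binomials relations"
      by (simp only: Q_rel_eq_binomials P_rel_eq_binomials binomials_def image_UN image_Un)
    then show ?thesis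
      using word_poly_diff_mem_genideal_iff[OF relations_lists w] by simp
  qed
  show ?thesis
    unfolding NF_def normal_form_def ideal
  proof (rule the_equality)
    show "normal w \<in> lists (alphabet I X) \<and>
        (\<forall>s\<in>(\<Union>i\<in>I. Q_rel (X i) \<union> R i). \<not> sublist (lm s) (normal w)) \<and> cong w (normal w)"
      using irreducible_iff normal_lists[OF w] normal_reduced[OF w] cong_normal[OF w] by blast
    fix v assume v: "v \<in> lists (alphabet I X) \<and>
        (\<forall>s\<in>(\<Union>i\<in>I. Q_rel (X i) \<union> R i). \<not> sublist (lm s) v) \<and> cong w v"
    then have "v \<in> reduced"
      using irreducible_iff by blast
    with v show "v = normal w"
      using cong_normal_eq[of w v] by (simp add: normal_id)
  qed
qed

lemma carrier_FP: "carrier (FP I X rI rX R) = {w \<in> reduced. \<exists>y\<in>set w. is_dotted y}"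
  by (auto simp: FP_def reduced_def Y3_iff subset_iff)

text \<open>The products of \<open>FP\<close> treat the left part, the two letters at the junction
  and the right part separately. \<open>normal_join\<close> identifies this with normalizing the
  whole concatenation, and pieces that keep their dots are already normal.\<close>

sublocale free_trioid I X rep "FP I X rI rX R"
proof (rule free_trioid.intro[OF trioid_family_axioms], rule free_trioid_axioms.intro)
  fix u v assume uv: "u \<in> carrier (FP I X rI rX R)" "v \<in> carrier (FP I X rI rX R)"
  then have "u \<noteq> []" "v \<noteq> []" and red: "u \<in> reduced" "v \<in> reduced"
    by (auto simp: carrier_FP)
  then obtain u' y z v' where u: "u = u' @ [y]" and v: "v = z # v'"
    by (metis append_butlast_last_id list.exhaust)
  have alphabet: "u' \<in> lists (alphabet I X)" "y \<in> alphabet I X" "z \<in> alphabet I X" "v' \<in> lists (alphabet I X)"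
    and red': "u' \<in> reduced" "v' \<in> reduced"
    and alternating: "successively (\<lambda>y z. idx y \<noteq> idx z) (u' @ [y])"
      "successively (\<lambda>y z. idx y \<noteq> idx z) (z # v')"
    using red unfolding u v by (auto simp: reduced_def successively_append_iff successively_Cons)
  have undot: "successively (\<lambda>y z. idx y \<noteq> idx z) (map undot w) \<longleftrightarrow>
      successively (\<lambda>y z. idx y \<noteq> idx z) w" for w
    by (simp add: successively_map)
  have NF: "NF I X rI rX R (map undot u') = normal (map undot u')"
    "NF I X rI rX R (map undot v') = normal (map undot v')"
    "Red I X rI rX R a b = normal [a, b]" if "a \<in> alphabet I X" "b \<in> alphabet I X" for a b
    using alphabet that by (auto simp: Red_def intro!: NF_eq_normal)
  show "u \<turnstile>\<^bsub>FP I X rI rX R\<^esub> v = normal (map undot u @ v)"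
    using normal_join[of "map undot u'" "undot y" z v'] undot[of "u' @ [y]"]
      undot_lists[OF alphabet(1)] alphabet alternating
    by (simp add: FP_def NF u v normal_id[OF red'(2)])
  show "u \<stileturn>\<^bsub>FP I X rI rX R\<^esub> v = normal (u @ map undot v)"
    using normal_join[of u' y "undot z" "map undot v'"] undot[of "z # v'"]
      undot_lists[OF alphabet(4)] alphabet alternating
    by (simp add: FP_def NF u v normal_id[OF red'(1)])
  show "u \<perp>\<^bsub>FP I X rI rX R\<^esub> v = normal (u @ v)"
    using normal_join[of u' y z v'] alphabet alternating
    by (simp add: FP_def NF u v normal_id[OF red'(1)] normal_id[OF red'(2)])
qed (rule carrier_FP)

end

theorem theorem3p10:
  fixes I :: "'i set"
    and X :: "'i \<Rightarrow> 'a trioid"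
    and rI :: "('i \<times> 'i) set"
    and rX :: "'i \<Rightarrow> ('a \<times> 'a) set"
    and R :: "'i \<Rightarrow> ('a letter list \<Rightarrow>\<^sub>0 'k::field) set"
  assumes "\<And>i. i \<in> I \<Longrightarrow> trioid (X i)"
    and "disjoint_family_on (\<lambda>i. carrier (X i)) I"
    and "well_order_on I rI"
    and "\<And>i. i \<in> I \<Longrightarrow> well_order_on (carrier (X i)) (rX i)"
    and "\<And>i. i \<in> I \<Longrightarrow>
           groebner_shirshov_basis (word_less I X rI rX) (Plain ` carrier (X i))
             (genideal (free_alg (Plain ` carrier (X i))) (P_rel (X i))) (R i)"
    and "\<And>i. i \<in> I \<Longrightarrow> P_rel (X i) \<subseteq> R i"
  shows "is_free_product TYPE('c) I X (FP I X rI rX R) (\<lambda>i x. [Dotted x])"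
proof -
  interpret gsb_family I X rI rX R
    by (rule gsb_family.intro) (fact assms)+
  show ?thesis
    by (rule free_product)
qed

end
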